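(* (a) Let $C\subset\mathbb{H}_n$ be small, $\varphi(\bar x,\bar y)\in\mathcal{L}_0(C)$, and $\bar b$ a tuple of elements of $\mathbb{H}_n\setminus C$ such that $\varphi(\bar x,\bar b)$ is consistent. Then $\varphi(\bar x,\bar b)$ divides over $C$ if and only if either $\varphi(\bar x,\bar b)$ has a conjunct of the form $x_i=b$ for some entry $b$ of $\bar b$, or $\varphi(\bar x,\bar y)\in\mathcal{L}_R(C)$ and $K^\varphi_n(\bar b/C)$. (b) Let $A,B,C\subset\mathbb{H}_n$ be small. Then $A\mathop{\perp\!\!\!\perp}^d_C B$ if and only if (i) $A\cap B\subseteq C$, and (ii) for every tuple $\bar b$ of elements of $B\setminus C$, if $K_n(\bar b/A\cup C)$ then $K_n(\bar b/C)$.
   Context: Fix $n\ge3$; $K_m$ is the complete graph on $m$ vertices. Language $\{R\}$, $R$ the symmetric irreflexive edge relation. $T_n$ is the complete theory of the generic $K_n$-free (Henson) graph: the unique countable $K_n$-free graph into which every finite $K_n$-free graph embeds as an induced subgraph and in which every isomorphism between finite induced subgraphs extends to an automorphism. $\mathbb{H}_n$ is a sufficiently saturated monster model of $T_n$; "$C\subset\mathbb{H}_n$" means $C$ is small. Dividing: a partial type $\pi(\bar x,\bar b)$ divides over $C$ if there is a $C$-indiscernible sequence $(\bar b^l)_{l<\omega}$ with $\bar b^0=\bar b$ such that $\bigcup_l\pi(\bar x,\bar b^l)$ is inconsistent; a formula divides if the type consisting of it does. $A\mathop{\perp\!\!\!\perp}^d_C B$ means $\operatorname{tp}(A/B\cup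 C)$ does not divide over $C$. $\mathcal{L}_0(C)$: conjunctions of atomic and negated atomic formulas with parameters from $C$, no conjunct $x=c$ ($x$ a variable, $c\in C$); for $\varphi(\bar x,\bar y)$ also no conjunct $x_i=x_j$ or $y_i=y_j$ with $i\ne j$; formulas symmetrically closed. "$\varphi(\bar x,\bar b)$ has conjunct $x_i=b$" means $\varphi(\bar x,\bar y)$ has a conjunct $x_i=y_j$ and $b=b_j$. $\mathcal{L}_R(C)$: those $\varphi(\bar x,\bar y)\in\mathcal{L}_0(C)$ with no conjunct $x_i=y_j$. $K_n(B/C)$ (for subsets $B,C$, used for disjoint ones): there is $B_0\subseteq B\cup C$, $|B_0|=n$, $B_0\cap C\ne\emptyset\ne B_0\cap B$, distinct elements of $B_0\cap C$ pairwise adjacent, and every element of $B_0\cap B$ adjacent to every element of $B_0\cap C$. For tuples use their sets of entries. $K^\varphi_n(\bar b/C)$ (for $\varphi\in\mathcal{L}_R(C)$, $\bar b$ from $\mathbb{H}_n\setminus C$, $\varphi(\bar x,\bar b)$ consistent): there is $B\subseteq\bar b$ with $0<|B|<n$ such that $\neg K_n(B/C)$ and $K_n(B/\bar aC)$ for all $\bar a\models\varphi(\bar x,\bar b)$.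
   Formalization: In the definition of K^φ_n(b/C), the condition K_n(B/aC) is read as K_n(B/(a∪C)∖B), so entries of a lying in B are not counted in the base; applied verbatim to non-disjoint sets, the definition makes (a) false (n=3, C empty, an unused variable x_2). *)

theory Defs
  imports Main
begin

unbundle cardinal_syntax

(* First-order formulas in the language of one binary relation. Free symbols (variables and
   parameters) come from an arbitrary type; bound variables are de Bruijn indices. *)

datatype 's tm = Sym 's | Bnd nat

datatype (syms: 's) fm =
    Tru
  | Eq "'s tm" "'s tm"
  | Adj "'s tm" "'s tm"
  | Neg "'s fm"
  | And "'s fm" "'s fm"
  | Exi "'s fm"

primrec wf_tm :: "nat \<Rightarrow> 's tm \<Rightarrow> bool" where
  "wf_tm k (Sym s) = True"
| "wf_tm k (Bnd i) = (i < k)"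

primrec wf_fm :: "nat \<Rightarrow> 's fm \<Rightarrow> bool" where
  "wf_fm k Tru = True"
| "wf_fm k (Eq s t) = (wf_tm k s \<and> wf_tm k t)"
| "wf_fm k (Adj s t) = (wf_tm k s \<and> wf_tm k t)"
| "wf_fm k (Neg \<phi>) = wf_fm k \<phi>"
| "wf_fm k (And \<phi> \<psi>) = (wf_fm k \<phi> \<and> wf_fm k \<psi>)"
| "wf_fm k (Exi \<phi>) = wf_fm (Suc k) \<phi>"

primrec val :: "('s \<Rightarrow> 'a) \<Rightarrow> 'a list \<Rightarrow> 's tm \<Rightarrow> 'a" where
  "val \<rho> e (Sym s) = \<rho> s"
| "val \<rho> e (Bnd i) = e ! i"

(* A structure is a relation R on a type; its universe is the whole type. *)
primrec holds :: "('a \<Rightarrow> 'a \<Rightarrow> bool) \<Rightarrow> ('s \<Rightarrow> 'a) \<Rightarrow> 'a list \<Rightarrow> 's fm \<Rightarrow> bool" where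
  "holds R \<rho> e Tru = True"
| "holds R \<rho> e (Eq s t) = (val \<rho> e s = val \<rho> e t)"
| "holds R \<rho> e (Adj s t) = R (val \<rho> e s) (val \<rho> e t)"
| "holds R \<rho> e (Neg \<phi>) = (\<not> holds R \<rho> e \<phi>)"
| "holds R \<rho> e (And \<phi> \<psi>) = (holds R \<rho> e \<phi> \<and> holds R \<rho> e \<psi>)"
| "holds R \<rho> e (Exi \<phi>) = (\<exists>a. holds R \<rho> (a # e) \<phi>)"

definition true_in :: "('a \<Rightarrow> 'a \<Rightarrow> bool) \<Rightarrow> unit fm \<Rightarrow> bool" where
  "true_in R \<sigma> \<longleftrightarrow> (\<forall>\<rho>. holds R \<rho> [] \<sigma>)"

definition sentences :: "unit fm set" where
  "sentences = {\<sigma>. wf_fm 0 \<sigma> \<and> syms \<sigma> = {}}"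

(* In a formula with parameters, Inl v is a variable and Inr c names the element c. *)

definition lang :: "'v set \<Rightarrow> 'a set \<Rightarrow> ('v + 'a) fm set" where
  "lang V C = {\<phi>. wf_fm 0 \<phi> \<and> syms \<phi> \<subseteq> V <+> C}"

definition models :: "('a \<Rightarrow> 'a \<Rightarrow> bool) \<Rightarrow> ('v \<Rightarrow> 'a) \<Rightarrow> ('v + 'a) fm \<Rightarrow> bool" where
  "models R \<rho> \<phi> \<longleftrightarrow> holds R (case_sum \<rho> id) [] \<phi>"

(* Consistency with the elementary diagram of the structure, i.e. finite satisfiability in it. *)
definition consistent :: "('a \<Rightarrow> 'a \<Rightarrow> bool) \<Rightarrow> ('v + 'a) fm set \<Rightarrow> bool" where
  "consistent R p \<longleftrightarrow> (\<forall>F. finite F \<and> F \<subseteq> p \<longrightarrow> (\<exists>\<rho>. \<forall>\<phi>\<in>F. models R \<rho> \<phi>))"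

definition tp :: "('a \<Rightarrow> 'a \<Rightarrow> bool) \<Rightarrow> 'a set \<Rightarrow> 'a set \<Rightarrow> ('a + 'a) fm set" where
  "tp R A D = {\<phi> \<in> lang A D. models R id \<phi>}"

(* From \<phi>(x,y), with x-variables Inl (Inl i), y-variables Inl (Inr j) and parameters Inr c,
   to \<phi>(x,b): each y-variable j is replaced by the parameter b j. *)
definition inst :: "('j \<Rightarrow> 'a) \<Rightarrow> (('i + 'j) + 'a) fm \<Rightarrow> ('i + 'a) fm" where
  "inst b = map_fm (case_sum (case_sum Inl (\<lambda>j. Inr (b j))) Inr)"

definition graph :: "('a \<Rightarrow> 'a \<Rightarrow> bool) \<Rightarrow> bool" where
  "graph R \<longleftrightarrow> (\<forall>u v. R u v \<longrightarrow> R v u) \<and> (\<forall>u. \<not> R u u)"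

definition clique_free :: "nat \<Rightarrow> 'a set \<Rightarrow> ('a \<Rightarrow> 'a \<Rightarrow> bool) \<Rightarrow> bool" where
  "clique_free n V R \<longleftrightarrow>
     \<not> (\<exists>S\<subseteq>V. finite S \<and> card S = n \<and> (\<forall>u\<in>S. \<forall>v\<in>S. u \<noteq> v \<longrightarrow> R u v))"

definition henson_graph :: "nat \<Rightarrow> (nat \<Rightarrow> nat \<Rightarrow> bool) \<Rightarrow> bool" where
  "henson_graph n G \<longleftrightarrow>
     graph G \<and> clique_free n UNIV G \<and>
     (\<forall>(V :: nat set) D. finite V \<and> graph D \<and> clique_free n V D \<longrightarrow>
        (\<exists>f. inj_on f V \<and> (\<forall>u\<in>V. \<forall>v\<in>V. D u v \<longleftrightarrow> G (f u) (f v)))) \<and>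
     (\<forall>V f. finite V \<and> inj_on f V \<and> (\<forall>u\<in>V. \<forall>v\<in>V. G u v \<longleftrightarrow> G (f u) (f v)) \<longrightarrow>
        (\<exists>g. bij g \<and> (\<forall>u v. G u v \<longleftrightarrow> G (g u) (g v)) \<and> (\<forall>u\<in>V. g u = f u)))"

(* Countable Henson graphs are infinite, hence copied onto nat, and unique up to isomorphism,
   so this is the complete theory of any one of them. *)
definition henson_theory :: "nat \<Rightarrow> unit fm set" where
  "henson_theory n = {\<sigma> \<in> sentences. \<forall>G. henson_graph n G \<longrightarrow> true_in G \<sigma>}"

definition small :: "'k rel \<Rightarrow> 'a set \<Rightarrow> bool" where
  "small \<kappa> C \<longleftrightarrow> |C| <o \<kappa>"

definition saturated :: "'k rel \<Rightarrow> ('a \<Rightarrow> 'a \<Rightarrow> bool) \<Rightarrow> bool" where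
  "saturated \<kappa> R \<longleftrightarrow>
     (\<forall>D (p :: (unit + 'a) fm set). small \<kappa> D \<and> p \<subseteq> lang UNIV D \<and> consistent R p \<longrightarrow>
        (\<exists>\<rho>. \<forall>\<phi>\<in>p. models R \<rho> \<phi>))"

definition henson_monster :: "nat \<Rightarrow> 'k rel \<Rightarrow> ('a \<Rightarrow> 'a \<Rightarrow> bool) \<Rightarrow> bool" where
  "henson_monster n \<kappa> R \<longleftrightarrow>
     Card_order \<kappa> \<and> natLeq <o \<kappa> \<and> (\<forall>\<sigma>\<in>henson_theory n. true_in R \<sigma>) \<and> saturated \<kappa> R"

(* s l is the l-th tuple, indexed by J; in a formula, (i, j) is the j-th entry of the i-th of the
   chosen tuples. *)
definition indiscernible ::
  "('a \<Rightarrow> 'a \<Rightarrow> bool) \<Rightarrow> 'a set \<Rightarrow> 'j set \<Rightarrow> (nat \<Rightarrow> 'j \<Rightarrow> 'a) \<Rightarrow> bool" where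
  "indiscernible R C J s \<longleftrightarrow>
     (\<forall>\<phi> \<in> lang (UNIV \<times> J) C. \<forall>g h :: nat \<Rightarrow> nat. strict_mono g \<and> strict_mono h \<longrightarrow>
        (models R (\<lambda>(i, j). s (g i) j) \<phi> \<longleftrightarrow> models R (\<lambda>(i, j). s (h i) j) \<phi>))"

(* divides R C J \<pi> b: the partial type \<pi>(x,b) divides over C, for a set \<pi>(x,y) of formulas
   over C and a tuple b indexed by J. *)
definition divides ::
  "('a \<Rightarrow> 'a \<Rightarrow> bool) \<Rightarrow> 'a set \<Rightarrow> 'j set \<Rightarrow> (('i + 'j) + 'a) fm set \<Rightarrow> ('j \<Rightarrow> 'a) \<Rightarrow> bool" where
  "divides R C J \<pi> b \<longleftrightarrow>
     (\<exists>s. indiscernible R C J s \<and> (\<forall>j\<in>J. s 0 j = b j) \<and>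
          \<not> consistent R (\<Union>l. inst (s l) ` \<pi>))"

(* A and B \<union> C are enumerated by themselves, so that the instances of the set below at the
   tuple id are exactly the members of tp(A / B \<union> C). *)
definition indep_d ::
  "('a \<Rightarrow> 'a \<Rightarrow> bool) \<Rightarrow> 'a set \<Rightarrow> 'a set \<Rightarrow> 'a set \<Rightarrow> bool" where
  "indep_d R A C B \<longleftrightarrow>
     \<not> divides R C (B \<union> C) {\<phi> \<in> lang (A <+> (B \<union> C)) {}. inst id \<phi> \<in> tp R A (B \<union> C)} id"

primrec conjuncts :: "'s fm \<Rightarrow> 's fm set" where
  "conjuncts Tru = {}"
| "conjuncts (Eq s t) = {Eq s t}"
| "conjuncts (Adj s t) = {Adj s t}"
| "conjuncts (Neg \<phi>) = {Neg \<phi>}"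
| "conjuncts (And \<phi> \<psi>) = conjuncts \<phi> \<union> conjuncts \<psi>"
| "conjuncts (Exi \<phi>) = {Exi \<phi>}"

definition literal :: "'s fm \<Rightarrow> bool" where
  "literal \<phi> \<longleftrightarrow>
     (\<exists>s t. \<phi> = Eq s t \<or> \<phi> = Adj s t \<or> \<phi> = Neg (Eq s t) \<or> \<phi> = Neg (Adj s t))"

definition sym_closed :: "'s fm \<Rightarrow> bool" where
  "sym_closed \<phi> \<longleftrightarrow>
     (\<forall>s t. (Eq s t \<in> conjuncts \<phi> \<longrightarrow> Eq t s \<in> conjuncts \<phi>) \<and>
            (Adj s t \<in> conjuncts \<phi> \<longrightarrow> Adj t s \<in> conjuncts \<phi>) \<and>
            (Neg (Eq s t) \<in> conjuncts \<phi> \<longrightarrow> Neg (Eq t s) \<in> conjuncts \<phi>) \<and>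
            (Neg (Adj s t) \<in> conjuncts \<phi> \<longrightarrow> Neg (Adj t s) \<in> conjuncts \<phi>))"

abbreviation xvar :: "nat \<Rightarrow> ((nat + nat) + 'a) tm" where
  "xvar i \<equiv> Sym (Inl (Inl i))"

abbreviation yvar :: "nat \<Rightarrow> ((nat + nat) + 'a) tm" where
  "yvar j \<equiv> Sym (Inl (Inr j))"

(* Formulas \<phi>(x,y) in tuples x of length k and y of length m. *)
definition L0 :: "nat \<Rightarrow> nat \<Rightarrow> 'a set \<Rightarrow> ((nat + nat) + 'a) fm set" where
  "L0 k m C = {\<phi> \<in> lang ({..<k} <+> {..<m}) C.
     (\<forall>\<psi>\<in>conjuncts \<phi>. literal \<psi>) \<and>
     (\<forall>v c. Eq (Sym (Inl v)) (Sym (Inr c)) \<notin> conjuncts \<phi>) \<and>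
     (\<forall>i j. i \<noteq> j \<longrightarrow> Eq (xvar i) (xvar j) \<notin> conjuncts \<phi> \<and>
                     Eq (yvar i) (yvar j) \<notin> conjuncts \<phi>) \<and>
     sym_closed \<phi>}"

definition LR :: "nat \<Rightarrow> nat \<Rightarrow> 'a set \<Rightarrow> ((nat + nat) + 'a) fm set" where
  "LR k m C = {\<phi> \<in> L0 k m C. \<forall>i j. Eq (xvar i) (yvar j) \<notin> conjuncts \<phi>}"

definition has_conjunct_eq :: "((nat + nat) + 'a) fm \<Rightarrow> 'a list \<Rightarrow> nat \<Rightarrow> 'a \<Rightarrow> bool" where
  "has_conjunct_eq \<phi> bs i b \<longleftrightarrow>
     (\<exists>j<length bs. Eq (xvar i) (yvar j) \<in> conjuncts \<phi> \<and> b = bs ! j)"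

definition Kn :: "('a \<Rightarrow> 'a \<Rightarrow> bool) \<Rightarrow> nat \<Rightarrow> 'a set \<Rightarrow> 'a set \<Rightarrow> bool" where
  "Kn R n B C \<longleftrightarrow>
     (\<exists>B0\<subseteq>B \<union> C. finite B0 \<and> card B0 = n \<and> B0 \<inter> C \<noteq> {} \<and> B0 \<inter> B \<noteq> {} \<and>
        (\<forall>u \<in> B0 \<inter> C. \<forall>v \<in> B0 \<inter> C. u \<noteq> v \<longrightarrow> R u v) \<and>
        (\<forall>u \<in> B0 \<inter> B. \<forall>v \<in> B0 \<inter> C. R u v))"

(* A realization as may meet B; since Kn is a relation between disjoint sets, such common
   elements are counted on the side of B only. (Without this, an x-variable not occurring in \<phi>
   could be assigned an element of B and would spoil Kn.) *)
definition Kn_phi ::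
  "('a \<Rightarrow> 'a \<Rightarrow> bool) \<Rightarrow> nat \<Rightarrow> nat \<Rightarrow> ((nat + nat) + 'a) fm \<Rightarrow> 'a list \<Rightarrow> 'a set \<Rightarrow> bool" where
  "Kn_phi R n k \<phi> bs C \<longleftrightarrow>
     (\<exists>B\<subseteq>set bs. 0 < card B \<and> card B < n \<and> \<not> Kn R n B C \<and>
        (\<forall>as. length as = k \<and> models R (nth as) (inst (nth bs) \<phi>) \<longrightarrow>
           Kn R n B ((set as \<union> C) - B)))"

end

theory Submission
  imports Defs
begin

text \<open>
  By saturation the monster realizes every one-point extension of a small set that creates no clique
  of size \<open>n\<close>; hence small clique-free graphs embed over small sets, and finite partial isomorphisms
  preserve all formulas, so that only edges and equalities matter for indiscernibility.

  In an indiscernible sequence corresponding points of two members are not adjacent, for otherwise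
  they would form an infinite clique. A clique in the union of the sequence, \<open>C\<close> and a new tuple joined
  to all members alike therefore projects injectively to the first member, where it witnesses
  \<open>K\<^sub>n(B/AC)\<close> for a finite \<open>B\<close>; if this implies \<open>K\<^sub>n(B/C)\<close>, there is already such a clique in the
  monster. Conversely, if \<open>K\<^sub>n(B/AC)\<close> but not \<open>K\<^sub>n(B/C)\<close>, one can spread \<open>B\<close> over an
  indiscernible sequence in which the transversals of \<open>B\<close> are cliques, and the type of \<open>A\<close> cannot be
  realized over all members at once.
\<close>

section \<open>Axioms of the Henson graphs\<close>

text \<open>\<open>Kn\<close> asks for no edges inside \<open>B\<close>, since the sequence itself
  can supply them: edges between copies of distinct points are independent of the edges in
  \<open>B\<close>. If \<open>Kn R n B1 C\<close> fails and \<open>B1\<close> has fewer than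
  \<open>n\<close> points, all these cross edges can be added at once; with \<open>n\<close> points
  a transversal alone would be a forbidden clique. Every \<open>Kn\<close> witness therefore has to
  be cut down to its two finite sides, \<open>B1\<close> and \<open>T\<close>, both nonempty. In (a)
  the obstacle is that a formula does not determine a type: \<open>Kn_phi\<close> speaks of all
  realizations, and different ones might have different witnesses, while both directions need one
  witness that serves all of them. A realization with as few edges as possible provides it. In (b)
  the type is complete, so \<open>A\<close> itself takes that place.\<close>

primrec conj_list :: "'s fm list \<Rightarrow> 's fm" where
  "conj_list [] = Tru"
| "conj_list (\<phi> # \<phi>s) = And \<phi> (conj_list \<phi>s)"

lemma holds_conj_list: "holds R \<rho> e (conj_list \<phi>s) \<longleftrightarrow> (\<forall>\<phi>\<in>set \<phi>s. holds R \<rho> e \<phi>)"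
  by (induction \<phi>s) auto

lemma wf_fm_conj_list: "wf_fm k (conj_list \<phi>s) \<longleftrightarrow> (\<forall>\<phi>\<in>set \<phi>s. wf_fm k \<phi>)"
  by (induction \<phi>s) auto

lemma syms_conj_list: "syms (conj_list \<phi>s) = (\<Union>\<phi>\<in>set \<phi>s. syms \<phi>)"
  by (induction \<phi>s) auto

lemma holds_Exi_pow:
  "holds R \<rho> e ((Exi ^^ p) \<phi>) \<longleftrightarrow> (\<exists>e'. length e' = p \<and> holds R \<rho> (e' @ e) \<phi>)"
proof (induction p arbitrary: e)
  case (Suc p)
  show ?case
  proof
    assume "holds R \<rho> e ((Exi ^^ Suc p) \<phi>)"
    then obtain a e' where "length e' = p" "holds R \<rho> (e' @ a # e) \<phi>"
      by (auto simp: Suc.IH)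
    then show "\<exists>e'. length e' = Suc p \<and> holds R \<rho> (e' @ e) \<phi>"
      by (intro exI[of _ "e' @ [a]"]) auto
  next
    assume "\<exists>e'. length e' = Suc p \<and> holds R \<rho> (e' @ e) \<phi>"
    then obtain e' where e': "length e' = Suc p" "holds R \<rho> (e' @ e) \<phi>" by blast
    then obtain e'' a where "e' = e'' @ [a]" by (metis length_Suc_conv_rev)
    with e' show "holds R \<rho> e ((Exi ^^ Suc p) \<phi>)"
      by (auto simp: Suc.IH intro!: exI[of _ a] exI[of _ e''])
  qed
qed auto

lemma wf_fm_Exi_pow: "wf_fm k ((Exi ^^ p) \<phi>) \<longleftrightarrow> wf_fm (p + k) \<phi>"
  by (induction p arbitrary: k) auto

lemma syms_Exi_pow: "syms ((Exi ^^ p) \<phi>) = syms \<phi>"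
  by (induction p) auto

lemma clique_freeI:
  assumes "\<And>S. S \<subseteq> V \<Longrightarrow> finite S \<Longrightarrow> card S = n \<Longrightarrow> (\<And>u v. u \<in> S \<Longrightarrow> v \<in> S \<Longrightarrow> u \<noteq> v \<Longrightarrow> R u v) \<Longrightarrow> False"
  shows "clique_free n V R"
  unfolding clique_free_def using assms by blast

lemma clique_freeD:
  assumes "clique_free n V R" "S \<subseteq> V" "finite S" "card S = n"
    "\<And>u v. u \<in> S \<Longrightarrow> v \<in> S \<Longrightarrow> u \<noteq> v \<Longrightarrow> R u v"
  shows False
  using assms unfolding clique_free_def by blast

lemma clique_free_subset: "clique_free n V R \<Longrightarrow> W \<subseteq> V \<Longrightarrow> clique_free n W R"
  by (rule clique_freeI, erule clique_freeD) auto

text \<open>Universality only supplies some copy of \<open>D\<close> with a new point joined to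
  \<open>U\<close>; homogeneity carries that copy back onto \<open>D\<close>. The enlarged graph has
  no clique of size \<open>n\<close>, because one through the new point would leave a clique of size
  \<open>n - 1\<close> in \<open>U\<close>.\<close>

lemma henson_graph_extension:
  assumes H: "henson_graph n G" and "0 < n" and fin: "finite D" and "U \<subseteq> D"
    and U: "clique_free (n - 1) U G"
  shows "\<exists>v. v \<notin> D \<and> (\<forall>d\<in>D. G v d \<longleftrightarrow> d \<in> U)"
proof -
  have G: "\<And>u v. G u v \<Longrightarrow> G v u" "\<And>u. \<not> G u u" and free: "clique_free n UNIV G"
    and universal: "\<And>(V :: nat set) E. finite V \<Longrightarrow> graph E \<Longrightarrow> clique_free n V E \<Longrightarrow>
      \<exists>f. inj_on f V \<and> (\<forall>u\<in>V. \<forall>v\<in>V. E u v \<longleftrightarrow> G (f u) (f v))"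
    and homogeneous: "\<And>V f. finite V \<Longrightarrow> inj_on f V \<Longrightarrow> \<forall>u\<in>V. \<forall>v\<in>V. G u v \<longleftrightarrow> G (f u) (f v) \<Longrightarrow>
      \<exists>g. bij g \<and> (\<forall>u v. G u v \<longleftrightarrow> G (g u) (g v)) \<and> (\<forall>u\<in>V. g u = f u)"
    using H unfolding henson_graph_def graph_def by simp_all
  obtain z where z: "z \<notin> D" using ex_new_if_finite[OF infinite_UNIV_nat fin] by blast
  define E where "E u v \<longleftrightarrow> (if u = z then v \<in> U else if v = z then u \<in> U else G u v)" for u v
  have zU: "z \<notin> U" using z \<open>U \<subseteq> D\<close> by blast
  have "graph E" unfolding graph_def E_def using G zU by auto
  moreover have "clique_free n (insert z D) E"
  proof (rule clique_freeI)
    fix S assume S: "S \<subseteq> insert z D" "finite S" "card S = n"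
      and E: "\<And>u v. u \<in> S \<Longrightarrow> v \<in> S \<Longrightarrow> u \<noteq> v \<Longrightarrow> E u v"
    show False
    proof (cases "z \<in> S")
      case True
      have "S - {z} \<subseteq> U" using E[OF True] by (auto simp: E_def)
      moreover have "card (S - {z}) = n - 1" using True S by simp
      moreover have "G u v" if "u \<in> S - {z}" "v \<in> S - {z}" "u \<noteq> v" for u v
        using E[of u v] that by (auto simp: E_def)
      ultimately show False using clique_freeD[OF U, of "S - {z}"] S by blast
    next
      case False
      have "G u v" if "u \<in> S" "v \<in> S" "u \<noteq> v" for u v
        using E[OF that] that False by (auto simp: E_def split: if_splits)
      then show False using clique_freeD[OF free, of S] S by blast
    qed
  qed
  ultimately obtain f where f: "inj_on f (insert z D)"
    "\<And>u v. u \<in> insert z D \<Longrightarrow> v \<in> insert z D \<Longrightarrow> E u v \<longleftrightarrow> G (f u) (f v)"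
    using universal[of "insert z D" E] fin by (metis finite_insert)
  define f' where "f' = inv_into D f"
  have inj_D: "inj_on f D" using f(1) by (rule inj_on_subset) auto
  have f': "\<And>d. d \<in> D \<Longrightarrow> f' (f d) = d" unfolding f'_def using inj_D by simp
  have "inj_on f' (f ` D)" unfolding f'_def by (rule inj_on_inv_into) auto
  moreover have "\<forall>u\<in>f ` D. \<forall>v\<in>f ` D. G u v \<longleftrightarrow> G (f' u) (f' v)"
  proof (intro ballI, elim imageE)
    fix u v d d' assume "u = f d" "d \<in> D" "v = f d'" "d' \<in> D"
    then show "G u v \<longleftrightarrow> G (f' u) (f' v)" using f' f(2)[of d d'] z by (auto simp: E_def split: if_splits)
  qed
  ultimately obtain g where g: "bij g" "\<And>u v. G u v \<longleftrightarrow> G (g u) (g v)" "\<And>u. u \<in> f ` D \<Longrightarrow> g u = f' u"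
    using homogeneous[of "f ` D" f'] fin by (metis finite_imageI)
  have gf: "g (f d) = d" if "d \<in> D" for d using g(3) f' that by auto
  have "g (f z) \<notin> D"
  proof
    assume "g (f z) \<in> D"
    then have "f (g (f z)) = f z" using gf g(1) by (metis bij_is_inj injD)
    then show False using f(1) z \<open>g (f z) \<in> D\<close> by (metis inj_on_contraD insertCI)
  qed
  moreover have "G (g (f z)) d \<longleftrightarrow> d \<in> U" if "d \<in> D" for d
  proof -
    have "G (g (f z)) d \<longleftrightarrow> G (f z) (f d)" using g(2) gf[OF that] by metis
    also have "\<dots> \<longleftrightarrow> E z d" using f(2) that by auto
    finally show ?thesis by (simp add: E_def)
  qed
  ultimately show ?thesis by blast
qed

definition lit :: "bool \<Rightarrow> 's fm \<Rightarrow> 's fm" where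
  "lit b \<phi> = (if b then \<phi> else Neg \<phi>)"

lemma lit_simps [simp]:
  "holds R \<rho> e (lit b \<phi>) \<longleftrightarrow> (holds R \<rho> e \<phi> \<longleftrightarrow> b)"
  "wf_fm k (lit b \<phi>) \<longleftrightarrow> wf_fm k \<phi>"
  "syms (lit b \<phi>) = syms \<phi>"
  by (auto simp: lit_def)

definition diagram :: "('a \<Rightarrow> 'a \<Rightarrow> bool) \<Rightarrow> 'a list \<Rightarrow> unit fm" where
  "diagram R ds = conj_list (map (\<lambda>(i, j).
     And (lit (ds ! i = ds ! j) (Eq (Bnd i) (Bnd j))) (lit (R (ds ! i) (ds ! j)) (Adj (Bnd i) (Bnd j))))
     (List.product [0..<length ds] [0..<length ds]))"

text \<open>One instance of the extension axiom scheme. \<open>R\<close> and \<open>ds\<close> only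
  serve as a blueprint for an isomorphism type: the sentence has no parameters and so carries the
  property from the countable graphs to the monster. Below the inner quantifier index 0 is the new
  point, hence the shift \<open>Suc i\<close>.\<close>

definition ext_sentence :: "('a \<Rightarrow> 'a \<Rightarrow> bool) \<Rightarrow> 'a list \<Rightarrow> 'a set \<Rightarrow> unit fm" where
  "ext_sentence R ds U = Neg ((Exi ^^ length ds) (And (diagram R ds) (Neg (Exi (conj_list
     (map (\<lambda>i. And (Neg (Eq (Bnd 0) (Bnd (Suc i)))) (lit (ds ! i \<in> U) (Adj (Bnd 0) (Bnd (Suc i)))))
     [0..<length ds]))))))"

lemma holds_diagram:
  "length es = length ds \<Longrightarrow> holds G \<rho> es (diagram R ds) \<longleftrightarrow>
     (\<forall>i<length ds. \<forall>j<length ds. (es ! i = es ! j \<longleftrightarrow> ds ! i = ds ! j) \<and>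
        (G (es ! i) (es ! j) \<longleftrightarrow> R (ds ! i) (ds ! j)))"
  unfolding diagram_def holds_conj_list by auto

lemma holds_ext_sentence:
  "holds G \<rho> [] (ext_sentence R ds U) \<longleftrightarrow>
     (\<forall>es. length es = length ds \<and> holds G \<rho> es (diagram R ds) \<longrightarrow>
       (\<exists>v. \<forall>i<length ds. v \<noteq> es ! i \<and> (G v (es ! i) \<longleftrightarrow> ds ! i \<in> U)))"
  unfolding ext_sentence_def by (auto simp: holds_Exi_pow holds_conj_list Ball_def)

lemma ext_sentence_sentence: "ext_sentence R ds U \<in> sentences"
  unfolding ext_sentence_def diagram_def sentences_def
  by (auto simp: wf_fm_Exi_pow syms_Exi_pow wf_fm_conj_list syms_conj_list)

text \<open>A tuple satisfying the diagram has the isomorphism type of \<open>ds\<close>, so a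
  clique at the positions of \<open>U\<close> could be copied back into \<open>U\<close>; thus
  \<open>henson_graph_extension\<close> applies in \<open>G\<close>.\<close>

lemma ext_sentence_henson:
  assumes "0 < n" "U \<subseteq> set ds" "clique_free (n - 1) U R"
  shows "ext_sentence R ds U \<in> henson_theory n"
  unfolding henson_theory_def
proof (intro CollectI conjI allI impI ext_sentence_sentence)
  fix G assume G: "henson_graph n G"
  show "true_in G (ext_sentence R ds U)"
    unfolding true_in_def holds_ext_sentence
  proof (intro allI impI, elim conjE)
    fix \<rho> :: "unit \<Rightarrow> nat" and es
    assume len: "length es = length ds" and "holds G \<rho> es (diagram R ds)"
    then have diag: "\<And>i j. i < length ds \<Longrightarrow> j < length ds \<Longrightarrow> (es ! i = es ! j \<longleftrightarrow> ds ! i = ds ! j) \<and>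
        (G (es ! i) (es ! j) \<longleftrightarrow> R (ds ! i) (ds ! j))"
      by (simp add: holds_diagram)
    define U' where "U' = {es ! i | i. i < length ds \<and> ds ! i \<in> U}"
    have U': "es ! i \<in> U' \<longleftrightarrow> ds ! i \<in> U" if "i < length ds" for i
      using diag that unfolding U'_def by auto
    have "\<exists>v. v \<notin> set es \<and> (\<forall>d\<in>set es. G v d \<longleftrightarrow> d \<in> U')"
    proof (rule henson_graph_extension[OF G assms(1)])
      show "U' \<subseteq> set es" using len by (auto simp: U'_def)
      show "clique_free (n - 1) U' G"
      proof (rule clique_freeI)
        fix S assume S: "S \<subseteq> U'" "finite S" "card S = n - 1"
          and cl: "\<And>u v. u \<in> S \<Longrightarrow> v \<in> S \<Longrightarrow> u \<noteq> v \<Longrightarrow> G u v"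
        have "\<forall>u\<in>S. \<exists>i. i < length ds \<and> ds ! i \<in> U \<and> u = es ! i" using S by (auto simp: U'_def)
        then obtain q where q: "\<And>u. u \<in> S \<Longrightarrow> q u < length ds \<and> ds ! q u \<in> U \<and> u = es ! q u"
          by metis
        have inj: "inj_on (\<lambda>u. ds ! q u) S" by (rule inj_onI) (metis q diag)
        show False
        proof (rule clique_freeD[OF assms(3), of "(\<lambda>u. ds ! q u) ` S"])
          show "card ((\<lambda>u. ds ! q u) ` S) = n - 1" using S inj by (simp add: card_image)
        next
          fix x y assume "x \<in> (\<lambda>u. ds ! q u) ` S" "y \<in> (\<lambda>u. ds ! q u) ` S" "x \<noteq> y"
          then obtain u v where uv: "u \<in> S" "v \<in> S" "u \<noteq> v" "x = ds ! q u" "y = ds ! q v" by auto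
          then show "R x y" using cl[OF uv(1-3)] q[OF uv(1)] q[OF uv(2)] diag by metis
        qed (use S q in auto)
      qed
    qed auto
    then obtain v where "v \<notin> set es" "\<forall>d\<in>set es. G v d \<longleftrightarrow> d \<in> U'" by blast
    then show "\<exists>v. \<forall>i<length ds. v \<noteq> es ! i \<and> (G v (es ! i) \<longleftrightarrow> ds ! i \<in> U)"
      using len U' by (intro exI[of _ v]) (metis nth_mem)
  qed
qed

section \<open>Sentences for symmetry, irreflexivity and the absence of cliques\<close>

definition symmetric_sentence :: "unit fm" where
  "symmetric_sentence = Neg (Exi (Exi (And (Adj (Bnd 0) (Bnd 1)) (Neg (Adj (Bnd 1) (Bnd 0))))))"

definition irreflexive_sentence :: "unit fm" where
  "irreflexive_sentence = Neg (Exi (Adj (Bnd 0) (Bnd 0)))"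

definition clique_free_sentence :: "nat \<Rightarrow> unit fm" where
  "clique_free_sentence n = Neg ((Exi ^^ n) (conj_list (map (\<lambda>(i, j).
     if i = j then Tru else And (Neg (Eq (Bnd i) (Bnd j))) (Adj (Bnd i) (Bnd j)))
     (List.product [0..<n] [0..<n]))))"

lemma holds_clique_free_sentence:
  "holds R \<rho> [] (clique_free_sentence n) \<longleftrightarrow>
     \<not> (\<exists>es. length es = n \<and> (\<forall>i<n. \<forall>j<n. i \<noteq> j \<longrightarrow> es ! i \<noteq> es ! j \<and> R (es ! i) (es ! j)))"
proof -
  have "(\<forall>x\<in>{0..<n} \<times> {0..<n}. holds R \<rho> es (case x of (i, j) \<Rightarrow>
      if i = j then Tru else And (Neg (Eq (Bnd i) (Bnd j))) (Adj (Bnd i) (Bnd j)))) \<longleftrightarrow>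
    (\<forall>i<n. \<forall>j<n. i \<noteq> j \<longrightarrow> es ! i \<noteq> es ! j \<and> R (es ! i) (es ! j))" for es
    by (auto simp: Ball_def)
  then show ?thesis by (simp add: clique_free_sentence_def holds_Exi_pow holds_conj_list)
qed

lemma clique_free_iff_list:
  "clique_free n UNIV R \<longleftrightarrow>
     \<not> (\<exists>es. length es = n \<and> (\<forall>i<n. \<forall>j<n. i \<noteq> j \<longrightarrow> es ! i \<noteq> es ! j \<and> R (es ! i) (es ! j)))"
proof -
  have "(\<exists>S. finite S \<and> card S = n \<and> (\<forall>u\<in>S. \<forall>v\<in>S. u \<noteq> v \<longrightarrow> R u v)) \<longleftrightarrow>
    (\<exists>es. length es = n \<and> (\<forall>i<n. \<forall>j<n. i \<noteq> j \<longrightarrow> es ! i \<noteq> es ! j \<and> R (es ! i) (es ! j)))"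
    (is "?l \<longleftrightarrow> ?r")
  proof
    assume ?l
    then obtain S where S: "finite S" "card S = n" "\<forall>u\<in>S. \<forall>v\<in>S. u \<noteq> v \<longrightarrow> R u v" by blast
    obtain es where es: "set es = S" "distinct es" using finite_distinct_list[OF S(1)] by blast
    then have "length es = n" using S distinct_card by fastforce
    with es S(3) show ?r by (intro exI[of _ es]) (auto simp: nth_eq_iff_index_eq)
  next
    assume ?r
    then obtain es where es: "length es = n"
      "\<forall>i<n. \<forall>j<n. i \<noteq> j \<longrightarrow> es ! i \<noteq> es ! j \<and> R (es ! i) (es ! j)" by blast
    then have "distinct es" by (auto simp: distinct_conv_nth)
    then have "card (set es) = n" using es(1) distinct_card by blast
    moreover have "\<forall>u\<in>set es. \<forall>v\<in>set es. u \<noteq> v \<longrightarrow> R u v"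
      using es by (auto simp: in_set_conv_nth) metis
    ultimately show ?l by blast
  qed
  then show ?thesis unfolding clique_free_def by auto
qed

lemma graph_sentences_henson:
  "symmetric_sentence \<in> henson_theory n" "irreflexive_sentence \<in> henson_theory n"
  "clique_free_sentence n \<in> henson_theory n"
proof -
  show "symmetric_sentence \<in> henson_theory n" "irreflexive_sentence \<in> henson_theory n"
    by (auto simp: henson_theory_def sentences_def symmetric_sentence_def irreflexive_sentence_def
      true_in_def henson_graph_def graph_def)
  have "clique_free_sentence n \<in> sentences"
    unfolding clique_free_sentence_def sentences_def
    by (auto simp: wf_fm_Exi_pow syms_Exi_pow wf_fm_conj_list syms_conj_list split: if_splits)
  then show "clique_free_sentence n \<in> henson_theory n"
    by (simp add: henson_theory_def true_in_def holds_clique_free_sentence henson_graph_def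
      clique_free_iff_list)
qed

text \<open>What is kept of the theory and of saturation: all later sections use the monster only
  through these properties. \<open>extension\<close> is saturation for the edge types of one new
  point; \<open>uncountable\<close> makes room for countably many copies of a small set.\<close>

locale henson_model =
  fixes n :: nat and \<kappa> :: "'k rel" and R :: "'a \<Rightarrow> 'a \<Rightarrow> bool"
  assumes n_pos: "0 < n"
    and Card_order: "Card_order \<kappa>" and uncountable: "natLeq <o \<kappa>"
    and sym: "R u v \<Longrightarrow> R v u" and irrefl: "\<not> R u u"
    and clique_free_R: "clique_free n UNIV R"
    and extension: "small \<kappa> D \<Longrightarrow> U \<subseteq> D \<Longrightarrow> clique_free (n - 1) U R \<Longrightarrow>
      \<exists>v. v \<notin> D \<and> (\<forall>d\<in>D. R v d \<longleftrightarrow> d \<in> U)"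

lemma henson_monster_model:
  fixes \<kappa> :: "'k rel" and R :: "'a \<Rightarrow> 'a \<Rightarrow> bool"
  assumes "0 < n" and M: "henson_monster n \<kappa> R"
  shows "henson_model n \<kappa> R"
proof
  have T: "\<And>\<sigma>. \<sigma> \<in> henson_theory n \<Longrightarrow> true_in R \<sigma>" and sat: "saturated \<kappa> R"
    using M unfolding henson_monster_def by blast+
  show "0 < n" "Card_order \<kappa>" "natLeq <o \<kappa>" using assms unfolding henson_monster_def by blast+
  show "R v u" if "R u v" for u v
    using T[OF graph_sentences_henson(1)] that by (auto simp: true_in_def symmetric_sentence_def)
  show "\<not> R u u" for u
    using T[OF graph_sentences_henson(2)] by (auto simp: true_in_def irreflexive_sentence_def)
  show "clique_free n UNIV R"
    using T[OF graph_sentences_henson(3)]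
    unfolding true_in_def holds_clique_free_sentence clique_free_iff_list by blast
  fix D U assume D: "small \<kappa> D" "U \<subseteq> D" "clique_free (n - 1) U R"
  define \<theta> where "\<theta> d = And (Neg (Eq (Sym (Inl ())) (Sym (Inr d))))
    (lit (d \<in> U) (Adj (Sym (Inl ())) (Sym (Inr d))))" for d
  have \<theta>: "models R \<rho> (\<theta> d) \<longleftrightarrow> \<rho> () \<noteq> d \<and> (R (\<rho> ()) d \<longleftrightarrow> d \<in> U)" for \<rho> d
    by (simp add: \<theta>_def models_def)
  have "consistent R (\<theta> ` D)" unfolding consistent_def
  proof (intro allI impI, elim conjE)
    fix F assume "finite F" "F \<subseteq> \<theta> ` D"
    then obtain D' where D': "D' \<subseteq> D" "finite D'" "F = \<theta> ` D'" by (metis finite_subset_image)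
    obtain ds where ds: "set ds = D'" using finite_list[OF D'(2)] by blast
    have "clique_free (n - 1) (U \<inter> D') R" using D(3) by (rule clique_free_subset) blast
    then have "ext_sentence R ds (U \<inter> D') \<in> henson_theory n"
      using ext_sentence_henson[OF assms(1), of "U \<inter> D'" ds] ds by blast
    \<comment> \<open>The axiom is read in the monster at the tuple \<open>ds\<close> itself, which
      satisfies its own diagram.\<close>
    from T[OF this] have "\<exists>v. \<forall>i<length ds. v \<noteq> ds ! i \<and> (R v (ds ! i) \<longleftrightarrow> ds ! i \<in> U \<inter> D')"
      unfolding true_in_def holds_ext_sentence by (auto simp: holds_diagram)
    then obtain v where "\<forall>d\<in>D'. v \<noteq> d \<and> (R v d \<longleftrightarrow> d \<in> U)"
      using ds by (metis IntE IntI in_set_conv_nth)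
    then show "\<exists>\<rho>. \<forall>\<phi>\<in>F. models R \<rho> \<phi>"
      by (intro exI[of _ "\<lambda>_. v"]) (auto simp: D'(3) \<theta>)
  qed
  moreover have "\<theta> ` D \<subseteq> lang UNIV D" by (auto simp: lang_def \<theta>_def)
  ultimately obtain \<rho> where "\<forall>\<phi>\<in>\<theta> ` D. models R \<rho> \<phi>"
    using sat D(1) unfolding saturated_def by blast
  then show "\<exists>v. v \<notin> D \<and> (\<forall>d\<in>D. R v d \<longleftrightarrow> d \<in> U)"
    by (intro exI[of _ "\<rho> ()"]) (auto simp: \<theta>)
qed

section \<open>Small partial isomorphisms\<close>

lemma (in henson_model) small_subset: "small \<kappa> B \<Longrightarrow> A \<subseteq> B \<Longrightarrow> small \<kappa> A"
  unfolding small_def using card_of_mono1 ordLeq_ordLess_trans by blast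

lemma (in henson_model) small_image: "small \<kappa> A \<Longrightarrow> small \<kappa> (f ` A)"
  unfolding small_def using card_of_image ordLeq_ordLess_trans by blast

lemma (in henson_model) infinite_Field: "\<not> finite (Field \<kappa>)"
  using uncountable Card_order card_of_Field_ordIso
  by (metis cinfinite_def cinfinite_mono natLeq_cinfinite ordLess_imp_ordLeq)

lemma (in henson_model) small_Un: "small \<kappa> A \<Longrightarrow> small \<kappa> B \<Longrightarrow> small \<kappa> (A \<union> B)"
  unfolding small_def using card_of_Un_ordLess_infinite_Field infinite_Field Card_order by blast

lemma (in henson_model) small_nat: "small \<kappa> (UNIV :: nat set)"
  unfolding small_def using uncountable card_of_nat ordIso_ordLess_trans by blast

lemma (in henson_model) small_finite: "finite A \<Longrightarrow> small \<kappa> A"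
  unfolding small_def
  using uncountable finite_iff_ordLess_natLeq ordLess_transitive by blast

text \<open>Adding the naturals makes \<open>W\<close> infinite even for finite \<open>B\<close>, so
  that its square has no larger cardinality.\<close>

lemma (in henson_model) small_nat_Times:
  assumes "small \<kappa> B" shows "small \<kappa> ((UNIV :: nat set) \<times> B)"
proof -
  define W where "W = (UNIV :: nat set) <+> B"
  have "infinite W" unfolding W_def by simp
  then have "|W \<times> W| =o |W|" by (rule card_of_Times_same_infinite)
  moreover have "small \<kappa> W" unfolding W_def Plus_def using small_Un small_image small_nat assms by metis
  ultimately have "small \<kappa> (W \<times> W)" unfolding small_def using ordIso_ordLess_trans by blast
  then have "small \<kappa> (map_prod projl projr ` (W \<times> W))" by (rule small_image)
  then show ?thesis by (rule small_subset) (force simp: W_def)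
qed

lemma (in henson_model) small_UN_nat:
  assumes "small \<kappa> B" shows "small \<kappa> (\<Union>l :: nat. s l ` B)"
proof -
  have "(\<Union>l :: nat. s l ` B) = (\<lambda>(l, b). s l b) ` (UNIV \<times> B)" by auto
  then show ?thesis using small_image[OF small_nat_Times[OF assms]] by simp
qed

text \<open>The standard refutation of a clique: by irreflexivity a map that sends its edges to
  edges of \<open>R\<close> is injective on it. Only edges have to be preserved, not
  non-edges.\<close>

lemma (in henson_model) no_clique_image:
  assumes "finite X" "card X = n" "\<And>u v. u \<in> X \<Longrightarrow> v \<in> X \<Longrightarrow> u \<noteq> v \<Longrightarrow> R (f u) (f v)"
  shows False
proof -
  have inj: "inj_on f X" using assms(3) irrefl by (metis inj_onI)
  show False
    by (rule clique_freeD[OF clique_free_R, of "f ` X"])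
      (use assms inj in \<open>auto simp: card_image\<close>)
qed

text \<open>A set of pairs rather than a function, so that unions of chains and converses stay of
  the same kind. The first graph may live on another type, where abstract graphs are built before
  they are embedded.\<close>

definition partial_iso :: "('v \<Rightarrow> 'v \<Rightarrow> bool) \<Rightarrow> ('a \<Rightarrow> 'a \<Rightarrow> bool) \<Rightarrow> ('v \<times> 'a) set \<Rightarrow> bool" where
  "partial_iso E R P \<longleftrightarrow>
     (\<forall>u x v y. (u, x) \<in> P \<longrightarrow> (v, y) \<in> P \<longrightarrow> (u = v \<longleftrightarrow> x = y) \<and> (E u v \<longleftrightarrow> R x y))"

lemma partial_isoI:
  assumes "\<And>u x v y. (u, x) \<in> P \<Longrightarrow> (v, y) \<in> P \<Longrightarrow> (u = v \<longleftrightarrow> x = y) \<and> (E u v \<longleftrightarrow> R x y)"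
  shows "partial_iso E R P"
  using assms unfolding partial_iso_def by blast

lemma partial_isoD:
  assumes "partial_iso E R P" "(u, x) \<in> P" "(v, y) \<in> P"
  shows "u = v \<longleftrightarrow> x = y" "E u v \<longleftrightarrow> R x y"
  using assms unfolding partial_iso_def by blast+

lemma partial_iso_subset: "partial_iso E R P \<Longrightarrow> Q \<subseteq> P \<Longrightarrow> partial_iso E R Q"
  unfolding partial_iso_def by blast

lemma partial_iso_converse: "partial_iso E R P \<Longrightarrow> partial_iso R E (P\<inverse>)"
  unfolding partial_iso_def by blast

text \<open>The image of \<open>v\<close> has to be joined exactly to the images \<open>U\<close> of
  the neighbours of \<open>v\<close>. A clique of size \<open>n - 1\<close> in \<open>U\<close>
  would pull back to one that \<open>v\<close> completes to size \<open>n\<close>.\<close>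

lemma (in henson_model) partial_iso_extend:
  assumes P: "partial_iso E R P" and small: "small \<kappa> (Range P)" and E: "graph E"
    and free: "clique_free n (insert v (Domain P)) E"
  shows "\<exists>y. partial_iso E R (insert (v, y) P)"
proof (cases "v \<in> Domain P")
  case True
  then obtain y where "insert (v, y) P = P" by blast
  then show ?thesis using P by metis
next
  case False
  define U where "U = {x. \<exists>u. (u, x) \<in> P \<and> E v u}"
  have "clique_free (n - 1) U R"
  proof (rule clique_freeI)
    fix S assume S: "S \<subseteq> U" "finite S" "card S = n - 1"
      and cl: "\<And>x y. x \<in> S \<Longrightarrow> y \<in> S \<Longrightarrow> x \<noteq> y \<Longrightarrow> R x y"
    from S(1) have "\<forall>x\<in>S. \<exists>u. (u, x) \<in> P \<and> E v u" by (auto simp: U_def)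
    then obtain q where q: "\<And>x. x \<in> S \<Longrightarrow> (q x, x) \<in> P \<and> E v (q x)" by metis
    have inj: "inj_on q S" by (rule inj_onI) (metis q partial_isoD(1)[OF P])
    have v: "v \<notin> q ` S" using q False by blast
    have Esym: "\<And>u v. E u v \<Longrightarrow> E v u" using E by (auto simp: graph_def)
    show False
    proof (rule clique_freeD[OF free, of "insert v (q ` S)"])
      show "card (insert v (q ` S)) = n" using v S inj n_pos by (simp add: card_image)
      fix u w assume uw: "u \<in> insert v (q ` S)" "w \<in> insert v (q ` S)" "u \<noteq> w"
      have "E u w" if "u \<in> q ` S" "w \<in> q ` S"
      proof -
        obtain x y where xy: "x \<in> S" "y \<in> S" "u = q x" "w = q y" using \<open>u \<in> q ` S\<close> \<open>w \<in> q ` S\<close> by blast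
        then have "R x y" using cl uw(3) by blast
        then show ?thesis using partial_isoD(2)[OF P] q xy by blast
      qed
      then show "E u w" using uw q Esym by auto
    qed (use q S in auto)
  qed
  moreover have "U \<subseteq> Range P" by (auto simp: U_def)
  ultimately obtain y where y: "y \<notin> Range P" "\<forall>d\<in>Range P. R y d \<longleftrightarrow> d \<in> U"
    using extension[OF small] by blast
  have *: "E v u \<longleftrightarrow> R y x" "E u v \<longleftrightarrow> R x y" if "(u, x) \<in> P" for u x
  proof -
    have "R y x \<longleftrightarrow> x \<in> U" using y(2) that by blast
    also have "\<dots> \<longleftrightarrow> E v u" using that partial_isoD(1)[OF P] unfolding U_def by blast
    finally show "E v u \<longleftrightarrow> R y x" by blast
    then show "E u v \<longleftrightarrow> R x y" using E sym by (auto simp: graph_def)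
  qed
  have "partial_iso E R (insert (v, y) P)"
  proof (rule partial_isoI)
    fix u x w z assume "(u, x) \<in> insert (v, y) P" "(w, z) \<in> insert (v, y) P"
    then consider "u = v" "x = y" "w = v" "z = y" | "u = v" "x = y" "(w, z) \<in> P"
      | "(u, x) \<in> P" "w = v" "z = y" | "(u, x) \<in> P" "(w, z) \<in> P" by auto
    then show "(u = w \<longleftrightarrow> x = z) \<and> (E u w \<longleftrightarrow> R x z)"
    proof cases
      case 1
      then show ?thesis using E irrefl by (auto simp: graph_def)
    next
      case 2
      then show ?thesis using *(1)[OF 2(3)] y(1) False by auto
    next
      case 3
      then show ?thesis using *(2)[OF 3(1)] y(1) False by auto
    next
      case 4
      then show ?thesis using partial_isoD[OF P] by blast
    qed
  qed
  then show ?thesis by blast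
qed

text \<open>A maximal partial isomorphism, given by Zorn's lemma, is defined on all of
  \<open>V\<close>, since a missing vertex could be added. Starting from \<open>f0\<close> keeps the
  points that already lie in the monster in place.\<close>

lemma (in henson_model) embedding_extension:
  fixes E :: "'v \<Rightarrow> 'v \<Rightarrow> bool"
  assumes V: "small \<kappa> V" "V0 \<subseteq> V" and E: "graph E" and free: "clique_free n V E"
    and f0: "partial_iso E R ((\<lambda>v. (v, f0 v)) ` V0)"
  obtains f where "\<And>v. v \<in> V0 \<Longrightarrow> f v = f0 v"
    "\<And>u v. u \<in> V \<Longrightarrow> v \<in> V \<Longrightarrow> (f u = f v \<longleftrightarrow> u = v) \<and> (R (f u) (f v) \<longleftrightarrow> E u v)"
proof -
  define P0 where "P0 = (\<lambda>v. (v, f0 v)) ` V0"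
  define Z where "Z = {P. partial_iso E R P \<and> Domain P \<subseteq> V \<and> P0 \<subseteq> P}"
  have "\<exists>M\<in>Z. \<forall>P\<in>Z. M \<subseteq> P \<longrightarrow> P = M"
  proof (rule subset_Zorn_nonempty)
    have "P0 \<in> Z" using f0 V(2) unfolding Z_def P0_def by auto
    then show "Z \<noteq> {}" by blast
    fix \<C> assume C: "\<C> \<noteq> {}" "subset.chain Z \<C>"
    then have CZ: "\<C> \<subseteq> Z" and ch: "\<And>P Q. P \<in> \<C> \<Longrightarrow> Q \<in> \<C> \<Longrightarrow> P \<subseteq> Q \<or> Q \<subseteq> P"
      unfolding subset.chain_def by auto
    have "partial_iso E R (\<Union>\<C>)"
    proof (rule partial_isoI)
      fix u x v y assume "(u, x) \<in> \<Union>\<C>" "(v, y) \<in> \<Union>\<C>"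
      then obtain P Q where "P \<in> \<C>" "(u, x) \<in> P" "Q \<in> \<C>" "(v, y) \<in> Q" by blast
      then obtain M where M: "M \<in> \<C>" "(u, x) \<in> M" "(v, y) \<in> M" using ch[of P Q] by blast
      then have "partial_iso E R M" using CZ unfolding Z_def by auto
      from partial_isoD[OF this M(2,3)] show "(u = v \<longleftrightarrow> x = y) \<and> (E u v \<longleftrightarrow> R x y)" by simp
    qed
    moreover obtain P where "P \<in> \<C>" using C(1) by blast
    moreover have "Domain Q \<subseteq> V" "P0 \<subseteq> Q" if "Q \<in> \<C>" for Q using CZ that unfolding Z_def by auto
    ultimately show "\<Union>\<C> \<in> Z" unfolding Z_def by fast
  qed
  then obtain M where "M \<in> Z" and max: "\<And>P. P \<in> Z \<Longrightarrow> M \<subseteq> P \<Longrightarrow> P = M" by metis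
  then have M: "partial_iso E R M" "Domain M \<subseteq> V" "P0 \<subseteq> M" unfolding Z_def by auto
  define f where "f v = (THE x. (v, x) \<in> M)" for v
  have f: "f v = x" if "(v, x) \<in> M" for v x
    unfolding f_def by (rule the_equality) (use that partial_isoD(1)[OF M(1)] in blast)+
  have "Range M = f ` Domain M" using f by (force simp: image_iff)
  then have small: "small \<kappa> (Range M)" using small_image small_subset V(1) M(2) by metis
  have dom: "(v, f v) \<in> M" if v: "v \<in> V" for v
  proof -
    have "clique_free n (insert v (Domain M)) E" using free by (rule clique_free_subset) (use v M in auto)
    then obtain y where y: "partial_iso E R (insert (v, y) M)"
      using partial_iso_extend[OF M(1) small E] by blast
    then have "insert (v, y) M = M" using v M by (intro max) (auto simp: Z_def)
    then show ?thesis using f by blast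
  qed
  show thesis
  proof (rule that)
    show "f v = f0 v" if "v \<in> V0" for v using f M(3) that unfolding P0_def by blast
    show "(f u = f v \<longleftrightarrow> u = v) \<and> (R (f u) (f v) \<longleftrightarrow> E u v)" if "u \<in> V" "v \<in> V" for u v
      using partial_isoD[OF M(1) dom[OF that(1)] dom[OF that(2)]] by blast
  qed
qed

section \<open>Elementarity of finite partial isomorphisms\<close>

lemma finite_syms: "finite (syms \<phi>)"
proof (induction \<phi>)
  have "finite (set_tm t)" for t :: "'b tm" by (cases t) auto
  then show "finite (syms (Eq s t))" "finite (syms (Adj s t))" for s t :: "'b tm" by auto
qed auto

lemma (in henson_model) partial_iso_forth:
  assumes P: "partial_iso R R P" "finite P"
  shows "\<exists>y. partial_iso R R (insert (x, y) P)"
proof (rule partial_iso_extend[OF P(1)])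
  show "small \<kappa> (Range P)" using P(2) by (intro small_finite) (simp add: finite_Range)
  show "graph R" using sym irrefl by (auto simp: graph_def)
  show "clique_free n (insert x (Domain P)) R" using clique_free_R by (rule clique_free_subset) auto
qed

lemma nth_mem_zip: "i < length e \<Longrightarrow> length e' = length e \<Longrightarrow> (e ! i, e' ! i) \<in> set (zip e e')"
  by (force simp: set_zip)

text \<open>Back-and-forth inside the induction on formulas: in the case \<open>Exi\<close> a
  witness is matched by \<open>partial_iso_forth\<close>, applied to the converse for the other
  direction. A formula has finitely many symbols, so the partial isomorphism is finite.\<close>

lemma (in henson_model) holds_partial_iso:
  assumes "wf_fm (length e) \<phi>" "length e' = length e"
    "partial_iso R R ((\<lambda>s. (\<rho> s, \<rho>' s)) ` syms \<phi> \<union> set (zip e e'))"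
  shows "holds R \<rho> e \<phi> \<longleftrightarrow> holds R \<rho>' e' \<phi>"
  using assms
proof (induction \<phi> arbitrary: e e')
  case (Eq s t)
  have "(val \<rho> e u, val \<rho>' e' u) \<in> (\<lambda>s. (\<rho> s, \<rho>' s)) ` syms (Eq s t) \<union> set (zip e e')" if "u \<in> {s, t}" for u
    using that Eq.prems(1,2) by (cases u) (auto intro: nth_mem_zip)
  from partial_isoD(1)[OF Eq.prems(3) this[of s] this[of t]] show ?case by simp
next
  case (Adj s t)
  have "(val \<rho> e u, val \<rho>' e' u) \<in> (\<lambda>s. (\<rho> s, \<rho>' s)) ` syms (Adj s t) \<union> set (zip e e')" if "u \<in> {s, t}" for u
    using that Adj.prems(1,2) by (cases u) (auto intro: nth_mem_zip)
  from partial_isoD(2)[OF Adj.prems(3) this[of s] this[of t]] show ?case by simp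
next
  case (Neg \<phi>)
  then show ?case by simp
next
  case (And \<phi> \<psi>)
  have "partial_iso R R ((\<lambda>s. (\<rho> s, \<rho>' s)) ` syms \<phi> \<union> set (zip e e'))"
    "partial_iso R R ((\<lambda>s. (\<rho> s, \<rho>' s)) ` syms \<psi> \<union> set (zip e e'))"
    by (rule partial_iso_subset[OF And.prems(3)]; auto)+
  then have "holds R \<rho> e \<phi> \<longleftrightarrow> holds R \<rho>' e' \<phi>" "holds R \<rho> e \<psi> \<longleftrightarrow> holds R \<rho>' e' \<psi>"
    using And.IH[of e e'] And.prems(1,2) by simp_all
  then show ?case by simp
next
  case (Exi \<phi>)
  let ?P = "(\<lambda>s. (\<rho> s, \<rho>' s)) ` syms \<phi> \<union> set (zip e e')"
  have P: "partial_iso R R ?P" "finite ?P" using Exi.prems(3) finite_syms by auto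
  have IH: "holds R \<rho> (a # e) \<phi> \<longleftrightarrow> holds R \<rho>' (a' # e') \<phi>" if "partial_iso R R (insert (a, a') ?P)" for a a'
    by (rule Exi.IH) (use Exi.prems that in auto)
  have "\<exists>a'. holds R \<rho>' (a' # e') \<phi>" if "holds R \<rho> (a # e) \<phi>" for a
    using partial_iso_forth[OF P, of a] IH that by blast
  moreover have "\<exists>a. holds R \<rho> (a # e) \<phi>" if a': "holds R \<rho>' (a' # e') \<phi>" for a'
  proof -
    obtain a where "partial_iso R R (insert (a', a) (?P\<inverse>))"
      using partial_iso_forth[OF partial_iso_converse[OF P(1)], of a'] P(2) finite_converse by metis
    from partial_iso_converse[OF this] have "partial_iso R R (insert (a, a') ?P)"
      by (rule partial_iso_subset) auto
    then show ?thesis using IH a' by blast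
  qed
  ultimately show ?case by auto
qed simp

lemma (in henson_model) holds_partial_iso_map:
  assumes "wf_fm 0 \<phi>"
    "\<And>s t. s \<in> syms \<phi> \<Longrightarrow> t \<in> syms \<phi> \<Longrightarrow> (\<sigma> s = \<sigma> t \<longleftrightarrow> \<tau> s = \<tau> t) \<and> (R (\<sigma> s) (\<sigma> t) \<longleftrightarrow> R (\<tau> s) (\<tau> t))"
  shows "holds R \<sigma> [] \<phi> \<longleftrightarrow> holds R \<tau> [] \<phi>"
  by (rule holds_partial_iso) (use assms in \<open>auto intro!: partial_isoI\<close>)

section \<open>Indiscernible sequences\<close>

text \<open>The share of indiscernibility that a common realization needs, indexed by points instead
  of positions. Edges between copies of distinct points in different members are left open, and a
  point may keep the same copy throughout.\<close>

definition copies :: "('a \<Rightarrow> 'a \<Rightarrow> bool) \<Rightarrow> 'a set \<Rightarrow> 'a set \<Rightarrow> (nat \<Rightarrow> 'a \<Rightarrow> 'a) \<Rightarrow> bool" where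
  "copies R C B s \<longleftrightarrow>
     (\<forall>l. \<forall>x\<in>B. s l x \<notin> C \<and> (\<forall>c\<in>C. R (s l x) c \<longleftrightarrow> R x c)) \<and>
     (\<forall>l. \<forall>x\<in>B. \<forall>y\<in>B. R (s l x) (s l y) \<longleftrightarrow> R x y) \<and>
     (\<forall>l m. \<forall>x\<in>B. \<forall>y\<in>B. s l x = s m y \<longrightarrow> x = y) \<and>
     (\<forall>l m. \<forall>x\<in>B. \<not> R (s l x) (s m x))"

lemma copiesD:
  assumes "copies R C B s" "x \<in> B"
  shows "s l x \<notin> C" "c \<in> C \<Longrightarrow> R (s l x) c \<longleftrightarrow> R x c" "y \<in> B \<Longrightarrow> R (s l x) (s l y) \<longleftrightarrow> R x y"
    "y \<in> B \<Longrightarrow> s l x = s m y \<Longrightarrow> x = y" "\<not> R (s l x) (s m x)"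
  using assms unfolding copies_def by blast+

lemma indiscernible_shift:
  assumes "indiscernible R C J s" "l < m" "\<phi> \<in> lang (UNIV \<times> J) C"
  shows "models R (\<lambda>(i, j). s (if i = 0 then l else m + i - 1) j) \<phi> \<longleftrightarrow> models R (\<lambda>(i, j). s i j) \<phi>"
proof -
  \<comment> \<open>Position 0 goes to \<open>l\<close> and position 1 to \<open>m\<close>; formulas
    about one or two members mention no other position.\<close>
  have "strict_mono (\<lambda>i. if i = 0 then l else m + i - 1)" "strict_mono (\<lambda>i :: nat. i)"
    using assms(2) by (auto simp: strict_mono_def)
  then show ?thesis using assms(1,3) unfolding indiscernible_def by blast
qed

lemma indiscernible_pair:
  assumes "indiscernible R C J s" "l < m" "j \<in> J" "j' \<in> J"
  shows "s l j = s m j' \<longleftrightarrow> s 0 j = s 1 j'" "R (s l j) (s m j') \<longleftrightarrow> R (s 0 j) (s 1 j')"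
proof -
  have "Eq (Sym (Inl (0, j))) (Sym (Inl (1, j'))) \<in> lang (UNIV \<times> J) C"
    "Adj (Sym (Inl (0, j))) (Sym (Inl (1, j'))) \<in> lang (UNIV \<times> J) C"
    using assms by (auto simp: lang_def)
  from this[THEN indiscernible_shift[OF assms(1,2)]]
  show "s l j = s m j' \<longleftrightarrow> s 0 j = s 1 j'" "R (s l j) (s m j') \<longleftrightarrow> R (s 0 j) (s 1 j')"
    by (simp_all add: models_def)
qed

lemma indiscernible_single:
  assumes "indiscernible R C J s" "j \<in> J" "j' \<in> J"
  shows "s l j = s l j' \<longleftrightarrow> s 0 j = s 0 j'" "R (s l j) (s l j') \<longleftrightarrow> R (s 0 j) (s 0 j')"
    "c \<in> C \<Longrightarrow> s l j = c \<longleftrightarrow> s 0 j = c" "c \<in> C \<Longrightarrow> R (s l j) c \<longleftrightarrow> R (s 0 j) c"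
proof -
  have *: "Eq (Sym (Inl (0, j))) (Sym (Inl (0, j'))) \<in> lang (UNIV \<times> J) C"
    "Adj (Sym (Inl (0, j))) (Sym (Inl (0, j'))) \<in> lang (UNIV \<times> J) C"
    "c \<in> C \<Longrightarrow> Eq (Sym (Inl (0, j))) (Sym (Inr c)) \<in> lang (UNIV \<times> J) C"
    "c \<in> C \<Longrightarrow> Adj (Sym (Inl (0, j))) (Sym (Inr c)) \<in> lang (UNIV \<times> J) C"
    using assms by (auto simp: lang_def)
  note shift = indiscernible_shift[OF assms(1), of l "Suc l"]
  show "s l j = s l j' \<longleftrightarrow> s 0 j = s 0 j'" "R (s l j) (s l j') \<longleftrightarrow> R (s 0 j) (s 0 j')"
    "c \<in> C \<Longrightarrow> s l j = c \<longleftrightarrow> s 0 j = c" "c \<in> C \<Longrightarrow> R (s l j) c \<longleftrightarrow> R (s 0 j) c"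
    using shift[OF _ *(1)] shift[OF _ *(2)] shift[OF _ *(3)] shift[OF _ *(4)]
    by (simp_all add: models_def)
qed

text \<open>A coincidence across two members makes the second entry constant: \<open>s 0 j\<close>
  equals both \<open>s 1 j'\<close> and \<open>s 2 j'\<close>, and the equality of these two moves
  down to members 0 and 1.\<close>

lemma indiscernible_eq:
  assumes ind: "indiscernible R C J s" and j: "j \<in> J" "j' \<in> J" and eq: "s l j = s m j'"
  shows "s 0 j = s 0 j'"
proof -
  have *: "s 0 j = s 0 j'" if "s l j = s m j'" "l < m" "j \<in> J" "j' \<in> J" for l m j j'
  proof -
    have "s 0 j = s 1 j'" using that indiscernible_pair(1)[OF ind, of l m] by blast
    moreover from this have "s 0 j = s 2 j'"
      using that indiscernible_pair(1)[OF ind, of 0 2 j j'] by simp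
    ultimately have "s 0 j' = s 1 j'"
      using that indiscernible_pair(1)[OF ind, of 1 2 j' j'] by simp
    with \<open>s 0 j = s 1 j'\<close> show ?thesis by simp
  qed
  consider "l < m" | "l = m" | "m < l" by linarith
  then show ?thesis
    using *[of l j m j'] *[of m j' l j] indiscernible_single(1)[OF ind j] j eq by cases auto
qed

lemma (in henson_model) indiscernible_nonadjacent:
  assumes ind: "indiscernible R C J s" and j: "j \<in> J"
  shows "\<not> R (s l j) (s m j)"
proof -
  have *: "\<not> R (s l j) (s m j)" if "l < m" for l m
  proof
    assume "R (s l j) (s m j)"
    then have "R (s 0 j) (s 1 j)" using indiscernible_pair(2)[OF ind \<open>l < m\<close> j j] by simp
    then have lt: "R (s k j) (s k' j)" if "k < k'" for k k'
      using indiscernible_pair(2)[OF ind that j j] by simp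
    show False
    proof (rule no_clique_image[of "{..<n}" "\<lambda>l. s l j"])
      fix u v :: nat assume "u \<noteq> v"
      then show "R (s u j) (s v j)" using lt sym by (metis linorder_neqE_nat)
    qed auto
  qed
  then show ?thesis using sym irrefl by (metis linorder_neqE_nat)
qed

lemma (in henson_model) copies_of_indiscernible:
  assumes ind: "indiscernible R C J s" and b: "\<And>j. j \<in> J \<Longrightarrow> s 0 j = b j"
    and B: "B \<subseteq> b ` J" "B \<inter> C = {}"
  obtains t where "copies R C B t" "\<And>l j. j \<in> J \<Longrightarrow> b j \<in> B \<Longrightarrow> t l (b j) = s l j"
proof
  \<comment> \<open>The tuple may repeat entries; \<open>q\<close> selects one position for each
    point, and \<open>indiscernible_single\<close> shows that the choice does not matter.\<close>
  define q where "q = inv_into J b"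
  define t where "t l x = s l (q x)" for l x
  have q: "q x \<in> J" "b (q x) = x" if "x \<in> B" for x
    unfolding q_def using B(1) that by (auto intro: inv_into_into f_inv_into_f)
  show "t l (b j) = s l j" if "j \<in> J" "b j \<in> B" for l j
    unfolding t_def using indiscernible_single(1)[OF ind q(1)[OF that(2)] that(1)] that q b by metis
  show "copies R C B t" unfolding copies_def
  proof (intro conjI allI ballI impI)
    fix l m x y assume x: "x \<in> B"
    note 1 = indiscernible_single[OF ind q(1)[OF x]]
    show "t l x \<notin> C"
      unfolding t_def using 1(3)[OF q(1)[OF x], of "s l (q x)" l] b q x B(2) by auto
    show "\<not> R (t l x) (t m x)"
      unfolding t_def using indiscernible_nonadjacent[OF ind q(1)[OF x]] by auto
    show "R (t l x) c \<longleftrightarrow> R x c" if "c \<in> C" for c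
      unfolding t_def using 1(4)[OF q(1)[OF x]] b q x that by auto
    assume y: "y \<in> B"
    show "R (t l x) (t l y) \<longleftrightarrow> R x y" 
      unfolding t_def using 1(2)[OF q(1)[OF y]] b q x y by metis
    show "x = y" if "t l x = t m y"
      using indiscernible_eq[OF ind q(1)[OF x] q(1)[OF y]] that b q x y unfolding t_def by metis
  qed
qed

text \<open>
  The points of \<open>A\<close> are joined to every copy \<open>s l x\<close> as they are to \<open>x\<close>. Since \<open>s l x\<close> and \<open>s m x\<close> are
  not adjacent, a clique projects injectively back to \<open>A \<union> B \<union> C\<close> and witnesses \<open>Kn\<close> there.
\<close>

lemma (in henson_model) copies_realization:
  assumes small: "small \<kappa> A" "small \<kappa> B" "small \<kappa> C" and disj: "A \<inter> B = {}" "B \<inter> C = {}"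
    and s: "copies R C B s"
    and Kn: "\<And>B'. finite B' \<Longrightarrow> B' \<subseteq> B \<Longrightarrow> Kn R n B' (A \<union> C) \<Longrightarrow> Kn R n B' C"
  obtains \<rho> where "\<And>c. c \<in> C \<Longrightarrow> \<rho> c = c"
    "\<And>l u v. u \<in> A \<union> B \<union> C \<Longrightarrow> v \<in> A \<union> B \<union> C \<Longrightarrow>
      ((if u \<in> B then s l u else \<rho> u) = (if v \<in> B then s l v else \<rho> v) \<longleftrightarrow> u = v) \<and>
      (R (if u \<in> B then s l u else \<rho> u) (if v \<in> B then s l v else \<rho> v) \<longleftrightarrow> R u v)"
proof -
  define D where "D = C \<union> (\<Union>l. s l ` B)"
  define p where "p d = (if d \<in> C then d else SOME x. x \<in> B \<and> (\<exists>l. d = s l x))" for d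
  have p_C: "p c = c" if "c \<in> C" for c using that by (simp add: p_def)
  have p_s: "p (s l x) = x" if "x \<in> B" for l x
  proof -
    have "(SOME y. y \<in> B \<and> (\<exists>m. s l x = s m y)) = x"
      by (rule some_equality) (use that copiesD(4)[OF s] in blast)+
    then show ?thesis using copiesD(1)[OF s that] by (simp add: p_def)
  qed
  have p_D: "d \<in> C \<or> (\<exists>l. p d \<in> B \<and> d = s l (p d))" if "d \<in> D" for d
    using that p_s unfolding D_def by auto
  \<comment> \<open>The amalgam: \<open>Inl\<close> holds points of the monster with their own
    edges, \<open>Inr\<close> a fresh copy of \<open>A\<close> that is joined to each
    \<open>d\<close> as \<open>A\<close> is to \<open>p d\<close>.\<close>
  define E :: "'a + 'a \<Rightarrow> 'a + 'a \<Rightarrow> bool" where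
    "E u v = (case (u, v) of (Inl d, Inl d') \<Rightarrow> R d d' | (Inl d, Inr a) \<Rightarrow> R (p d) a
      | (Inr a, Inl d) \<Rightarrow> R a (p d) | (Inr a, Inr a') \<Rightarrow> R a a')" for u v
  have E: "E (Inl d) (Inl d') = R d d'" "E (Inl d) (Inr a) = R (p d) a"
    "E (Inr a) (Inl d) = R a (p d)" "E (Inr a) (Inr a') = R a a'" for d d' a a'
    by (simp_all add: E_def)
  define V where "V = Inl ` D \<union> Inr ` (A - C)"
  have graph: "graph E" unfolding graph_def E_def using sym irrefl by (auto split: sum.splits)
  have free: "clique_free n V E"
  proof (rule clique_freeI)
    fix S assume S: "S \<subseteq> V" "finite S" "card S = n"
      and cl: "\<And>u v. u \<in> S \<Longrightarrow> v \<in> S \<Longrightarrow> u \<noteq> v \<Longrightarrow> E u v"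
    define q where "q = case_sum p (\<lambda>a. a)"
    define N where "N = {d. Inl d \<in> S \<and> d \<notin> C}"
    have fin_N: "finite N" using finite_vimageI[OF S(2), of Inl] by (rule rev_finite_subset) (auto simp: N_def)
    have N: "p d \<in> B \<and> (\<exists>l. d = s l (p d))" if "d \<in> N" for d
      using that S(1) p_D unfolding N_def V_def by auto
    have SC: "q u \<in> A \<union> C" if "u \<in> S" "u \<notin> Inl ` N" for u
      using that S(1) p_D p_C unfolding N_def V_def q_def by (auto split: sum.splits)
    \<comment> \<open>Between two copies the projection may lose an edge; every other edge
      survives.\<close>
    have q_adj: "R (q u) (q v)" if uv: "u \<in> S" "v \<in> S" "u \<noteq> v" "u \<notin> Inl ` N" for u v
    proof -
      have Euv: "E u v" using cl uv by blast
      show ?thesis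
      proof (cases u)
        case (Inr a)
        then show ?thesis using Euv by (cases v) (auto simp: E q_def)
      next
        case (Inl c)
        then have c: "c \<in> C" using uv unfolding N_def by auto
        show ?thesis
        proof (cases v)
          case (Inr a)
          then show ?thesis using Inl Euv by (auto simp: E q_def)
        next
          case v: (Inl d)
          then have "R c d" using Inl Euv by (auto simp: E)
          moreover have "d \<in> D" using v uv(2) S(1) unfolding V_def by auto
          ultimately have "R c (p d)"
            using p_D[of d] p_C copiesD(2)[OF s _ c] sym by metis
          then show ?thesis using Inl v c p_C by (simp add: q_def)
        qed
      qed
    qed
    have N_adj: "R d d'" if "d \<in> N" "d' \<in> N" "d \<noteq> d'" for d d'
      using cl[of "Inl d" "Inl d'"] that unfolding N_def by (auto simp: E)
    have inj_N: "inj_on p N"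
    proof (rule inj_onI, rule ccontr)
      fix d d' assume *: "d \<in> N" "d' \<in> N" "p d = p d'" "d \<noteq> d'"
      then show False using N_adj[OF *(1,2,4)] N[OF *(1)] N[OF *(2)] copiesD(5)[OF s] by metis
    qed
    have inj: "inj_on q S"
    proof (rule inj_onI, rule ccontr)
      fix u v assume *: "u \<in> S" "v \<in> S" "q u = q v" "u \<noteq> v"
      then have "u \<in> Inl ` N" "v \<in> Inl ` N" using q_adj irrefl by metis+
      then obtain d d' where "u = Inl d" "v = Inl d'" "d \<in> N" "d' \<in> N" by blast
      then show False using inj_onD[OF inj_N, of d d'] *(3,4) by (simp add: q_def)
    qed
    show False
    \<comment> \<open>Without a fresh point the clique already lies in the monster; a fresh point
      supplies the member from \<open>A\<close> that a witness of \<open>Kn\<close> needs.\<close>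
    proof (cases "\<exists>a. Inr a \<in> S")
      case False
      then have "S \<subseteq> range Inl" by (metis obj_sumE rangeI subsetI)
      show False
      proof (rule no_clique_image[OF S(2,3), of projl])
        fix u v assume "u \<in> S" "v \<in> S" "u \<noteq> v"
        moreover from this obtain d d' where "u = Inl d" "v = Inl d'" using \<open>S \<subseteq> range Inl\<close> by blast
        ultimately show "R (projl u) (projl v)" using cl[of u v] by (simp add: E)
      qed
    next
      case True
      then obtain a where a: "Inr a \<in> S" by blast
      have pN: "p ` N \<subseteq> B" using N by blast
      have "Kn R n (p ` N) (A \<union> C)" if "N \<noteq> {}" unfolding Kn_def
      proof (intro exI[of _ "q ` S"] conjI ballI impI)
        have "q u \<in> p ` N \<union> (A \<union> C)" if "u \<in> S" for u
          using SC[OF that] by (cases "u \<in> Inl ` N") (auto simp: q_def)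
        then show "q ` S \<subseteq> p ` N \<union> (A \<union> C)" by blast
        show "finite (q ` S)" "card (q ` S) = n" using S inj by (auto simp: card_image)
        have "a \<in> A" using a S(1) by (auto simp: V_def)
        then show "q ` S \<inter> (A \<union> C) \<noteq> {}" using a by (force simp: q_def)
        show "q ` S \<inter> p ` N \<noteq> {}" using that unfolding N_def q_def by force
        have out: "u \<notin> Inl ` N" if "u \<in> S" "q u \<in> A \<union> C" for u
          using that pN disj by (auto simp: q_def) blast+
        {
          fix x y assume "x \<in> q ` S \<inter> (A \<union> C)" "y \<in> q ` S \<inter> (A \<union> C)" "x \<noteq> y"
          then obtain u v where "x = q u" "y = q v" "u \<in> S" "v \<in> S" "u \<noteq> v" "u \<notin> Inl ` N"
            using out by blast
          then show "R x y" using q_adj by blast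
        next
          fix x y assume "x \<in> q ` S \<inter> p ` N" "y \<in> q ` S \<inter> (A \<union> C)"
          moreover from this have "x \<noteq> y" using pN disj by blast
          ultimately obtain u v where "x = q u" "y = q v" "u \<in> S" "v \<in> S" "v \<noteq> u" "v \<notin> Inl ` N"
            using out by blast
          then show "R x y" using q_adj[of v u] sym by blast
        }
      qed
      then have "Kn R n (p ` N) C" if "N \<noteq> {}" using Kn fin_N pN that by simp
      \<comment> \<open>The copies in \<open>N\<close> form a clique and have the same neighbours in
        \<open>C\<close> as their projections. Lifting one side of a witness to \<open>N\<close> by
        \<open>r\<close> would therefore give a clique of size \<open>n\<close> in the
        monster.\<close>
      moreover have "\<not> Kn R n (p ` N) C"
      proof
        assume "Kn R n (p ` N) C"
        then obtain B0 where B0: "B0 \<subseteq> p ` N \<union> C" "finite B0" "card B0 = n"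
          "\<forall>u\<in>B0 \<inter> C. \<forall>v\<in>B0 \<inter> C. u \<noteq> v \<longrightarrow> R u v"
          "\<forall>u\<in>B0 \<inter> p ` N. \<forall>v\<in>B0 \<inter> C. R u v"
          unfolding Kn_def by (elim exE conjE)
        define r where "r x = (if x \<in> C then x else inv_into N p x)" for x
        have r: "r x \<in> N \<and> p (r x) = x \<and> x \<in> B" if "x \<in> B0" "x \<notin> C" for x
        proof -
          have "x \<in> p ` N" using that B0(1) by blast
          then show ?thesis
            using that N inv_into_into[of x p N] f_inv_into_f[of x p N] unfolding r_def by auto
        qed
        show False
        proof (rule no_clique_image[OF B0(2,3), of r])
          have *: "R (r u) (r v)" if uv: "u \<in> B0" "u \<notin> C" "v \<in> B0" "v \<in> C" for u v
          proof -
            have "R u v" using B0(1,5) uv by blast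
            moreover obtain l where "r u = s l u" "u \<in> B" using r[OF uv(1,2)] N by metis
            ultimately have "R (r u) v" using copiesD(2)[OF s _ uv(4)] by simp
            then show ?thesis using uv by (simp add: r_def)
          qed
          fix u v assume uv: "u \<in> B0" "v \<in> B0" "u \<noteq> v"
          consider "u \<in> C" "v \<in> C" | "u \<in> C" "v \<notin> C" | "u \<notin> C" "v \<in> C" | "u \<notin> C" "v \<notin> C" by blast
          then show "R (r u) (r v)"
          proof cases
            case 1
            then show ?thesis using B0(4) uv by (simp add: r_def)
          next
            case 4
            then show ?thesis using N_adj[of "r u" "r v"] r uv by metis
          qed (use * sym uv in blast)+
        qed
      qed
      ultimately have "N = {}" by blast
      show False by (rule no_clique_image[OF S(2,3), of q]) (use q_adj \<open>N = {}\<close> in blast)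
    qed
  qed
  have small_V: "small \<kappa> V"
    unfolding V_def D_def
    by (intro small_Un small_image small small_UN_nat small_subset[OF small(1)]) auto
  have V0: "Inl ` D \<subseteq> V" unfolding V_def by blast
  have "partial_iso E R ((\<lambda>v. (v, projl v)) ` Inl ` D)"
    by (rule partial_isoI) (auto simp: E)
  from embedding_extension[OF small_V V0 graph free this]
  obtain f where f: "\<And>v. v \<in> Inl ` D \<Longrightarrow> f v = projl v"
    "\<And>u v. u \<in> V \<Longrightarrow> v \<in> V \<Longrightarrow> (f u = f v \<longleftrightarrow> u = v) \<and> (R (f u) (f v) \<longleftrightarrow> E u v)"
    by blast
  define \<rho> where "\<rho> a = (if a \<in> C then a else f (Inr a))" for a
  show thesis
  proof (rule that)
    show "\<rho> c = c" if "c \<in> C" for c using that by (simp add: \<rho>_def)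
    fix l u v assume uv: "u \<in> A \<union> B \<union> C" "v \<in> A \<union> B \<union> C"
    \<comment> \<open>\<open>h\<close> locates the points at level \<open>l\<close> in the amalgam;
      \<open>C\<close> is tested first because \<open>A\<close> may meet it.\<close>
    define h where "h x = (if x \<in> C then Inl x else if x \<in> B then Inl (s l x) else Inr x)" for x
    have "f (Inl x) = x" if "x \<in> C" for x using f(1)[of "Inl x"] that by (simp add: D_def)
    moreover have "f (Inl (s l x)) = s l x" if "x \<in> B" for x
      using f(1)[of "Inl (s l x)"] that by (auto simp: D_def)
    ultimately have fh: "(if x \<in> B then s l x else \<rho> x) = f (h x)" for x
      using disj(2) unfolding h_def \<rho>_def by auto
    have hV: "h x \<in> V" if "x \<in> A \<union> B \<union> C" for x
      using that unfolding h_def V_def D_def by auto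
    have "s l x \<noteq> c" if "x \<in> B" "c \<in> C" for x c
      using copiesD(1)[OF s that(1)] that by blast
    moreover have "s l x = s l y \<longleftrightarrow> x = y" if "x \<in> B" "y \<in> B" for x y
      using copiesD(4)[OF s that] by blast
    ultimately have "h u = h v \<longleftrightarrow> u = v"
      unfolding h_def by auto
    moreover have "E (h u) (h v) \<longleftrightarrow> R u v"
    proof -
      have "R c (s l x) \<longleftrightarrow> R c x" if "c \<in> C" "x \<in> B" for c x
        using copiesD(2)[OF s that(2,1)] sym by blast
      then show ?thesis
        using uv copiesD(2,3)[OF s, of _ _ l] p_C p_s unfolding h_def by (simp add: E)
    qed
    ultimately show "((if u \<in> B then s l u else \<rho> u) = (if v \<in> B then s l v else \<rho> v) \<longleftrightarrow> u = v) \<and>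
      (R (if u \<in> B then s l u else \<rho> u) (if v \<in> B then s l v else \<rho> v) \<longleftrightarrow> R u v)"
      unfolding fh using f(2)[OF hV[OF uv(1)] hV[OF uv(2)]] by simp
  qed
qed

section \<open>Copies with cross edges\<close>

text \<open>
  If \<open>B1\<close> is a set of fewer than \<open>n\<close> points without \<open>Kn R n B1 C\<close>, then copies of \<open>B\<close> over \<open>C\<close>
  can be joined along distinct points of \<open>B1\<close> without creating a clique of size \<open>n\<close>: a clique that
  meets two copies meets them in distinct points of \<open>B1\<close>. A transversal of \<open>B1\<close> through the copies
  is then a clique, so no point set can be joined to all of them as \<open>Kn\<close> demands.
\<close>

definition crossed_copies ::
  "('a \<Rightarrow> 'a \<Rightarrow> bool) \<Rightarrow> 'a set \<Rightarrow> 'a set \<Rightarrow> 'a set \<Rightarrow> (nat \<Rightarrow> 'a \<Rightarrow> 'a) \<Rightarrow> bool" where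
  "crossed_copies R B1 B C s \<longleftrightarrow>
     (\<forall>x\<in>B. s 0 x = x) \<and> (\<forall>l. \<forall>c\<in>C. s l c = c) \<and>
     (\<forall>l. \<forall>x\<in>B. s l x \<notin> C \<and> (\<forall>c\<in>C. R (s l x) c \<longleftrightarrow> R x c)) \<and>
     (\<forall>l m. \<forall>x\<in>B. \<forall>y\<in>B. (s l x = s m y \<longleftrightarrow> l = m \<and> x = y) \<and>
        (R (s l x) (s m y) \<longleftrightarrow> (if l = m then R x y else x \<in> B1 \<and> y \<in> B1 \<and> x \<noteq> y)))"

lemma crossed_copiesD:
  assumes "crossed_copies R B1 B C s"
  shows "x \<in> B \<Longrightarrow> s 0 x = x" "c \<in> C \<Longrightarrow> s l c = c" "x \<in> B \<Longrightarrow> s l x \<notin> C"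
    "x \<in> B \<Longrightarrow> c \<in> C \<Longrightarrow> R (s l x) c \<longleftrightarrow> R x c"
    "x \<in> B \<Longrightarrow> y \<in> B \<Longrightarrow> s l x = s m y \<longleftrightarrow> l = m \<and> x = y"
    "x \<in> B \<Longrightarrow> y \<in> B \<Longrightarrow> R (s l x) (s m y) \<longleftrightarrow> (if l = m then R x y else x \<in> B1 \<and> y \<in> B1 \<and> x \<noteq> y)"
  using assms unfolding crossed_copies_def by blast+

lemma (in henson_model) crossed_copies_exist:
  assumes small: "small \<kappa> B" "small \<kappa> C" and disj: "B \<inter> C = {}"
    and B1: "B1 \<subseteq> B" "finite B1" "card B1 < n" "\<not> Kn R n B1 C"
  shows "\<exists>s. crossed_copies R B1 B C s"
proof -
  define E :: "'a + nat \<times> 'a \<Rightarrow> 'a + nat \<times> 'a \<Rightarrow> bool" where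
    "E u v = (case (u, v) of (Inl c, Inl c') \<Rightarrow> R c c' | (Inl c, Inr (l, x)) \<Rightarrow> R c x
      | (Inr (l, x), Inl c) \<Rightarrow> R x c
      | (Inr (l, x), Inr (m, y)) \<Rightarrow> if l = m then R x y else x \<in> B1 \<and> y \<in> B1 \<and> x \<noteq> y)" for u v
  have E: "E (Inl c) (Inl c') = R c c'" "E (Inl c) (Inr (l, x)) = R c x"
    "E (Inr (l, x)) (Inl c) = R x c"
    "E (Inr (l, x)) (Inr (m, y)) = (if l = m then R x y else x \<in> B1 \<and> y \<in> B1 \<and> x \<noteq> y)"
    for c c' x y l m by (simp_all add: E_def)
  define V where "V = Inl ` C \<union> Inr ` ((UNIV :: nat set) \<times> B)"
  \<comment> \<open>The copy with index 0 and \<open>C\<close> are embedded identically, so that the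
    sequence starts with \<open>B\<close> itself.\<close>
  define V0 where "V0 = Inl ` C \<union> Inr ` ({0 :: nat} \<times> B)"
  define q :: "'a + nat \<times> 'a \<Rightarrow> 'a" where "q = case_sum (\<lambda>c. c) snd"
  have graph: "graph E"
    unfolding graph_def E_def using sym irrefl by (auto split: sum.splits if_splits prod.splits)
  have free: "clique_free n V E"
  proof (rule clique_freeI)
    fix S assume S: "S \<subseteq> V" "finite S" "card S = n"
      and cl: "\<And>u v. u \<in> S \<Longrightarrow> v \<in> S \<Longrightarrow> u \<noteq> v \<Longrightarrow> E u v"
    have q_adj: "R (q u) (q v)" if "u \<in> S" "v \<in> S" "u \<noteq> v" "u \<in> range Inl" for u v
    proof (cases v)
      case (Inl c)
      then show ?thesis using cl[OF that(1-3)] that(4) by (auto simp: E q_def)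
    next
      case (Inr w)
      then show ?thesis using cl[OF that(1-3)] that(4) by (cases w) (auto simp: E q_def)
    qed
    show False
    proof (cases "\<exists>l m x y. Inr (l, x) \<in> S \<and> Inr (m, y) \<in> S \<and> l \<noteq> m")
      case False
      show False
      proof (rule no_clique_image[OF S(2,3), of q])
        fix u v assume uv: "u \<in> S" "v \<in> S" "u \<noteq> v"
        show "R (q u) (q v)"
        proof (cases "u \<in> range Inl \<or> v \<in> range Inl")
          case True
          then show ?thesis using q_adj[of u v] q_adj[of v u] sym uv by blast
        next
          case F: False
          then obtain l x m y where w: "u = Inr (l, x)" "v = Inr (m, y)"
            by (metis obj_sumE prod.exhaust rangeI)
          then have "l = m" using False uv by blast
          then show ?thesis using cl[OF uv] w by (simp add: E q_def)
        qed
      qed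
    next
      case True
      then obtain l0 m0 x0 y0 where lm: "Inr (l0, x0) \<in> S" "Inr (m0, y0) \<in> S" "l0 \<noteq> m0" by blast
      \<comment> \<open>One of the two vertices found lies outside copy \<open>l\<close>, and edges
        between different copies only join points of \<open>B1\<close>.\<close>
      have inB1: "x \<in> B1" if x: "Inr (l, x) \<in> S" for l x
      proof (cases "l = l0")
        case True
        then show ?thesis using cl[OF x lm(2)] lm(3) by (simp add: E)
      next
        case False
        then show ?thesis using cl[OF x lm(1)] by (simp add: E)
      qed
      have inj: "inj_on q S"
      proof (rule inj_onI, rule ccontr)
        fix u v assume uv: "u \<in> S" "v \<in> S" "q u = q v" "u \<noteq> v"
        have "u \<notin> range Inl" "v \<notin> range Inl" using q_adj uv irrefl by metis+
        then obtain l x m y where w: "u = Inr (l, x)" "v = Inr (m, y)"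
            by (metis obj_sumE prod.exhaust rangeI)
        then show False using cl[OF uv(1,2,4)] uv(3) irrefl by (simp add: E q_def split: if_splits)
      qed
      have B1C: "B1 \<inter> C = {}" using B1(1) disj by blast
      have side: "(u \<in> range Inl \<longleftrightarrow> q u \<in> C) \<and> (u \<notin> range Inl \<longleftrightarrow> q u \<in> B1)" if "u \<in> S" for u
      proof (cases u)
        case (Inl c)
        then show ?thesis using that S(1) B1C by (auto simp: V_def q_def)
      next
        case (Inr w)
        then show ?thesis using that inB1[of "fst w" "snd w"] B1C by (auto simp: q_def)
      qed
      \<comment> \<open>This is where \<open>card B1 < n\<close> enters: the projected clique has
        \<open>n\<close> points and cannot fit into \<open>B1\<close> alone.\<close>
      have "q ` S \<inter> C \<noteq> {}"
      proof
        assume "q ` S \<inter> C = {}"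
        then have "q ` S \<subseteq> B1" using side by blast
        then have "card (q ` S) \<le> card B1" using B1(2) by (rule card_mono[rotated])
        then show False using B1(3) S(3) inj by (simp add: card_image)
      qed
      moreover have "q ` S \<inter> B1 \<noteq> {}" using lm(1) inB1[OF lm(1)] by (force simp: q_def)
      moreover have adj: "R x y" if xy: "x \<in> q ` S" "y \<in> q ` S \<inter> C" "x \<noteq> y" for x y
      proof -
        obtain u v where "x = q u" "y = q v" "u \<in> S" "v \<in> S" "v \<noteq> u" "v \<in> range Inl"
          using xy side by blast
        then show ?thesis using q_adj[of v u] sym by blast
      qed
      moreover have "R x y" if "x \<in> q ` S \<inter> B1" "y \<in> q ` S \<inter> C" for x y
        using adj[of x y] that B1C by blast
      moreover have "q ` S \<subseteq> B1 \<union> C" using side by blast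
      moreover have "finite (q ` S)" "card (q ` S) = n" using S inj by (auto simp: card_image)
      ultimately have "Kn R n B1 C"
        unfolding Kn_def by (intro exI[of _ "q ` S"] conjI ballI impI) auto
      then show False using B1(4) by blast
    qed
  qed
  have small_V: "small \<kappa> V"
    unfolding V_def by (intro small_Un small_image small small_nat_Times)
  have V0: "V0 \<subseteq> V" unfolding V_def V0_def by blast
  have "partial_iso E R ((\<lambda>v. (v, q v)) ` V0)"
    unfolding V0_def
    by (rule partial_isoI) (use disj in \<open>auto simp: E q_def\<close>)
  from embedding_extension[OF small_V V0 graph free this]
  obtain f where f: "\<And>v. v \<in> V0 \<Longrightarrow> f v = q v"
    "\<And>u v. u \<in> V \<Longrightarrow> v \<in> V \<Longrightarrow> (f u = f v \<longleftrightarrow> u = v) \<and> (R (f u) (f v) \<longleftrightarrow> E u v)"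
    by blast
  have fc: "f (Inl c) = c" if "c \<in> C" for c using f(1)[of "Inl c"] that by (simp add: V0_def q_def)
  have f0: "f (Inr (0, x)) = x" if "x \<in> B" for x
    using f(1)[of "Inr (0, x)"] that by (simp add: V0_def q_def)
  have VI: "c \<in> C \<Longrightarrow> Inl c \<in> V" "x \<in> B \<Longrightarrow> Inr (l, x) \<in> V" for c l x by (auto simp: V_def)
  define s where "s l x = (if x \<in> C then x else f (Inr (l, x)))" for l x
  have sB: "s l x = f (Inr (l, x))" if "x \<in> B" for l x using that disj by (auto simp: s_def)
  have "crossed_copies R B1 B C s" unfolding crossed_copies_def
  proof (intro conjI allI ballI)
    fix l m x assume x: "x \<in> B"
    show "s 0 x = x" using f0 sB x by simp
    have "f (Inr (l, x)) \<noteq> f (Inl c)" "R (f (Inr (l, x))) (f (Inl c)) \<longleftrightarrow> R x c" if "c \<in> C" for c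
      using f(2)[OF VI(2)[OF x] VI(1)[OF that]] by (auto simp: E)
    then show "s l x \<notin> C" "\<And>c. c \<in> C \<Longrightarrow> R (s l x) c \<longleftrightarrow> R x c"
      using fc sB[OF x] by auto
    fix y assume y: "y \<in> B"
    show "s l x = s m y \<longleftrightarrow> l = m \<and> x = y"
      "R (s l x) (s m y) \<longleftrightarrow> (if l = m then R x y else x \<in> B1 \<and> y \<in> B1 \<and> x \<noteq> y)"
      using f(2)[OF VI(2)[OF x] VI(2)[OF y], of l m] sB[OF x] sB[OF y] by (auto simp: E)
  qed (simp add: s_def)
  then show ?thesis by blast
qed

lemma (in henson_model) crossed_copies_transfer:
  assumes s: "crossed_copies R B1 B C s" and x: "x \<in> B \<union> C" and y: "y \<in> B \<union> C"
    and lm: "l = m \<longleftrightarrow> l' = m'"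
  shows "(s l x = s m y \<longleftrightarrow> s l' x = s m' y) \<and> (R (s l x) (s m y) \<longleftrightarrow> R (s l' x) (s m' y))"
proof -
  note D = crossed_copiesD[OF s]
  have symm: "R u v \<longleftrightarrow> R v u" for u v using sym by blast
  consider "x \<in> B" "y \<in> B" | "x \<in> B" "y \<in> C" | "x \<in> C" "y \<in> B" | "x \<in> C" "y \<in> C"
    using x y by blast
  then show ?thesis
  proof cases
    case 1
    then show ?thesis using D(5)[OF 1] D(6)[OF 1] lm by simp
  next
    case 2
    then show ?thesis using D(3)[OF 2(1)] D(4)[OF 2] D(2)[OF 2(2)] by metis
  next
    case 3
    then show ?thesis using D(3)[OF 3(2)] D(4)[OF 3(2,1)] D(2)[OF 3(1)] symm by metis
  next
    case 4
    then show ?thesis using D(2) by simp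
  qed
qed

text \<open>A strictly increasing choice of indices enters only through its injectivity: edges and
  equalities between copies depend on whether the indices agree, and they decide every
  formula.\<close>

lemma (in henson_model) crossed_copies_indiscernible:
  fixes J :: "'j set"
  assumes s: "crossed_copies R B1 B C s" and b: "b ` J \<subseteq> B \<union> C"
  shows "indiscernible R C J (\<lambda>l j. s l (b j))"
  unfolding indiscernible_def models_def
proof (intro ballI allI impI, elim conjE)
  fix \<phi> :: "((nat \<times> 'j) + 'a) fm" and g h :: "nat \<Rightarrow> nat"
  assume \<phi>: "\<phi> \<in> lang (UNIV \<times> J) C" and mono: "strict_mono g" "strict_mono h"
  \<comment> \<open>Parameters from \<open>C\<close> get the dummy index 0, which is harmless as
    every \<open>s l\<close> fixes \<open>C\<close>.\<close>
  define k :: "nat \<times> 'j + 'a \<Rightarrow> nat" where "k = case_sum fst (\<lambda>_. 0)"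
  define z :: "nat \<times> 'j + 'a \<Rightarrow> 'a" where "z = case_sum (\<lambda>(i, j). b j) (\<lambda>c. c)"
  have k: "g (k u) = g (k v) \<longleftrightarrow> h (k u) = h (k v)" for u v
    using mono by (simp add: strict_mono_eq)
  have syms: "u \<in> UNIV \<times> J <+> C" if "u \<in> syms \<phi>" for u using that \<phi> by (auto simp: lang_def)
  have z: "z u \<in> B \<union> C" if "u \<in> syms \<phi>" for u
    using syms[OF that] b by (auto simp: z_def)
  have val: "case_sum (\<lambda>(i, j). s (f i) (b j)) id u = s (f (k u)) (z u)" if "u \<in> syms \<phi>" for u f
    using syms[OF that] crossed_copiesD(2)[OF s] by (auto simp: k_def z_def)
  show "holds R (case_sum (\<lambda>(i, j). s (g i) (b j)) id) [] \<phi> \<longleftrightarrow>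
    holds R (case_sum (\<lambda>(i, j). s (h i) (b j)) id) [] \<phi>"
  proof (rule holds_partial_iso_map)
    show "wf_fm 0 \<phi>" using \<phi> by (simp add: lang_def)
    fix u v assume uv: "u \<in> syms \<phi>" "v \<in> syms \<phi>"
    show "(case_sum (\<lambda>(i, j). s (g i) (b j)) id u = case_sum (\<lambda>(i, j). s (g i) (b j)) id v \<longleftrightarrow>
        case_sum (\<lambda>(i, j). s (h i) (b j)) id u = case_sum (\<lambda>(i, j). s (h i) (b j)) id v) \<and>
      (R (case_sum (\<lambda>(i, j). s (g i) (b j)) id u) (case_sum (\<lambda>(i, j). s (g i) (b j)) id v) \<longleftrightarrow>
        R (case_sum (\<lambda>(i, j). s (h i) (b j)) id u) (case_sum (\<lambda>(i, j). s (h i) (b j)) id v))"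
      unfolding val[OF uv(1)] val[OF uv(2)]
      by (rule crossed_copies_transfer[OF s z[OF uv(1)] z[OF uv(2)] k])
  qed
qed

text \<open>Here \<open>Kn\<close> turns into inconsistency: \<open>e\<close> numbers the points of
  \<open>B1\<close>, and taking each \<open>y\<close> from copy \<open>e y\<close> gives points in
  different copies, hence a clique, whatever the edges inside \<open>B1\<close>. The image of
  \<open>T\<close> completes it to size \<open>n\<close>, so \<open>card B1\<close> instances
  already contradict one another.\<close>

lemma (in henson_model) crossed_copies_no_clique:
  assumes s: "crossed_copies R B1 B C s" and B1: "B1 \<subseteq> B" "finite B1"
    and T: "finite T" "card B1 + card T = n"
    and \<tau>: "\<And>x y. x \<in> T \<Longrightarrow> y \<in> T \<Longrightarrow> x \<noteq> y \<Longrightarrow> R (\<tau> x) (\<tau> y)"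
      "\<And>x y l. x \<in> T \<Longrightarrow> y \<in> B1 \<Longrightarrow> l < card B1 \<Longrightarrow> R (\<tau> x) (s l y)"
  shows False
proof -
  obtain e where e: "bij_betw e B1 {0..<card B1}" using ex_bij_betw_finite_nat[OF B1(2)] by blast
  show False
  proof (rule no_clique_image[of "B1 <+> T" "case_sum (\<lambda>y. s (e y) y) \<tau>"])
    show "finite (B1 <+> T)" "card (B1 <+> T) = n" using B1 T by (auto simp: card_Plus)
    fix u v assume uv: "u \<in> B1 <+> T" "v \<in> B1 <+> T" "u \<noteq> v"
    have lt: "e y < card B1" if "y \<in> B1" for y using e that by (auto simp: bij_betw_def)
    have BB: "R (s (e x) x) (s (e y) y)" if "x \<in> B1" "y \<in> B1" "x \<noteq> y" for x y
    proof -
      have "e x \<noteq> e y" using e that by (metis bij_betw_def inj_onD)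
      then show ?thesis using crossed_copiesD(6)[OF s, of x y "e x" "e y"] B1(1) that by auto
    qed
    show "R (case_sum (\<lambda>y. s (e y) y) \<tau> u) (case_sum (\<lambda>y. s (e y) y) \<tau> v)"
      using uv BB \<tau> lt sym by (cases u; cases v) auto
  qed
qed

section \<open>Generic realizations\<close>

lemma holds_map_fm: "holds R \<rho> e (map_fm f \<phi>) \<longleftrightarrow> holds R (\<rho> \<circ> f) e \<phi>"
proof (induction \<phi> arbitrary: e)
  have "val \<rho> e (map_tm f t) = val (\<rho> \<circ> f) e t" for e t by (cases t) auto
  then show "holds R \<rho> e (map_fm f (Eq s t)) \<longleftrightarrow> holds R (\<rho> \<circ> f) e (Eq s t)"
    "holds R \<rho> e (map_fm f (Adj s t)) \<longleftrightarrow> holds R (\<rho> \<circ> f) e (Adj s t)" for e s t by simp_all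
qed auto

lemma models_inst:
  "models R \<rho> (inst b \<phi>) \<longleftrightarrow> holds R (case_sum (case_sum \<rho> b) id) [] \<phi>"
proof -
  have "case_sum \<rho> id \<circ> case_sum (case_sum Inl (\<lambda>j. Inr (b j))) Inr = case_sum (case_sum \<rho> b) id"
    by (rule ext) (auto split: sum.splits)
  then show ?thesis by (simp add: models_def inst_def holds_map_fm)
qed

lemma holds_conjuncts: "holds R \<rho> e \<phi> \<longleftrightarrow> (\<forall>\<psi>\<in>conjuncts \<phi>. holds R \<rho> e \<psi>)"
  by (induction \<phi>) auto

lemma conjuncts_wf: "\<psi> \<in> conjuncts \<phi> \<Longrightarrow> wf_fm k \<phi> \<Longrightarrow> wf_fm k \<psi> \<and> syms \<psi> \<subseteq> syms \<phi>"
  by (induction \<phi>) auto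

lemma not_consistentI:
  assumes "finite F" "F \<subseteq> p" "\<And>\<rho>. (\<And>\<phi>. \<phi> \<in> F \<Longrightarrow> models R \<rho> \<phi>) \<Longrightarrow> False"
  shows "\<not> consistent R p"
proof
  assume "consistent R p"
  then obtain \<rho> where "\<forall>\<phi>\<in>F. models R \<rho> \<phi>" using assms(1,2) unfolding consistent_def by blast
  then show False using assms(3) by blast
qed

lemma Kn_cases:
  assumes "Kn R n B C" "B \<inter> C = {}"
  obtains B1 T where "B1 \<subseteq> B" "T \<subseteq> C" "finite B1" "finite T" "B1 \<noteq> {}" "T \<noteq> {}"
    "card B1 + card T = n" "\<forall>u\<in>T. \<forall>v\<in>T. u \<noteq> v \<longrightarrow> R u v"
    "\<forall>u\<in>B1. \<forall>v\<in>T. R u v"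
proof -
  obtain B0 where B0: "B0 \<subseteq> B \<union> C" "finite B0" "card B0 = n" "B0 \<inter> C \<noteq> {}" "B0 \<inter> B \<noteq> {}"
    "\<forall>u\<in>B0 \<inter> C. \<forall>v\<in>B0 \<inter> C. u \<noteq> v \<longrightarrow> R u v" "\<forall>u\<in>B0 \<inter> B. \<forall>v\<in>B0 \<inter> C. R u v"
    using assms(1) unfolding Kn_def by (elim exE conjE)
  have "B0 = (B0 \<inter> B) \<union> (B0 \<inter> C)" using B0(1) by blast
  then have "card B0 = card (B0 \<inter> B) + card (B0 \<inter> C)"
    using card_Un_disjoint[of "B0 \<inter> B" "B0 \<inter> C"] B0(2) assms(2) by auto
  then show thesis by (intro that[of "B0 \<inter> B" "B0 \<inter> C"]) (use B0 in auto)
qed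

lemma KnI:
  assumes "B \<inter> C = {}" "B1 \<subseteq> B" "T \<subseteq> C" "finite B1" "finite T" "B1 \<noteq> {}" "T \<noteq> {}"
    "card B1 + card T = n" "\<And>u v. u \<in> T \<Longrightarrow> v \<in> T \<Longrightarrow> u \<noteq> v \<Longrightarrow> R u v"
    "\<And>u v. u \<in> B1 \<Longrightarrow> v \<in> T \<Longrightarrow> R u v"
  shows "Kn R n B C"
proof -
  have *: "(B1 \<union> T) \<inter> B = B1" "(B1 \<union> T) \<inter> C = T" using assms(1-3) by blast+
  have "card (B1 \<union> T) = n" using card_Un_disjoint[of B1 T] assms by auto
  then show ?thesis
    unfolding Kn_def by (intro exI[of _ "B1 \<union> T"]) (use assms * in auto)
qed

text \<open>Used in contrapositive form: the failure of \<open>Kn\<close> passes from a set to its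
  part \<open>B1\<close> in a witness, which is finite and has fewer than \<open>n\<close> points
  because the other side is nonempty.\<close>

lemma Kn_mono:
  assumes "Kn R n B' C" "B' \<subseteq> B" "B \<inter> C = {}"
  shows "Kn R n B C"
proof -
  have "B' \<inter> C = {}" using assms by blast
  then obtain B1 T where "B1 \<subseteq> B'" "T \<subseteq> C" "finite B1" "finite T" "B1 \<noteq> {}" "T \<noteq> {}"
    "card B1 + card T = n" "\<forall>u\<in>T. \<forall>v\<in>T. u \<noteq> v \<longrightarrow> R u v"
    "\<forall>u\<in>B1. \<forall>v\<in>T. R u v"
    by (rule Kn_cases[OF assms(1)])
  then show ?thesis by (intro KnI[of B C B1 T]) (use assms(2,3) in auto)
qed

lemma not_Kn_empty: "\<not> Kn R n {} C"
  unfolding Kn_def by blast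

lemma LR_literal_cases:
  assumes \<phi>: "\<phi> \<in> LR k m C" and \<psi>: "\<psi> \<in> conjuncts \<phi>"
  obtains s t where "s \<in> ({..<k} <+> {..<m}) <+> C" "t \<in> ({..<k} <+> {..<m}) <+> C"
    "\<psi> = Eq (Sym s) (Sym t) \<or> \<psi> = Adj (Sym s) (Sym t) \<or> \<psi> = Neg (Eq (Sym s) (Sym t)) \<or>
     \<psi> = Neg (Adj (Sym s) (Sym t))"
proof -
  have "literal \<psi>" and \<phi>': "\<phi> \<in> lang ({..<k} <+> {..<m}) C" using \<phi> \<psi> by (auto simp: LR_def L0_def)
  moreover have wf: "wf_fm 0 \<psi>" "syms \<psi> \<subseteq> ({..<k} <+> {..<m}) <+> C"
    using conjuncts_wf[OF \<psi>, of 0] \<phi>' unfolding lang_def by auto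
  ultimately obtain s t where st: "\<psi> = Eq s t \<or> \<psi> = Adj s t \<or> \<psi> = Neg (Eq s t) \<or> \<psi> = Neg (Adj s t)"
    unfolding literal_def by blast
  then have "wf_tm 0 s" "wf_tm 0 t" using wf(1) by auto
  then obtain s' t' where "s = Sym s'" "t = Sym t'" by (metis not_less0 tm.exhaust wf_tm.simps(2))
  then show thesis using that[of s' t'] st wf(2) by auto
qed

text \<open>
  A realization of \<open>\<phi>(x,b)\<close> with only the edges that \<open>\<phi>\<close> prescribes exists, because a clique in it would
  map to a clique of the given realization \<open>\<rho>0\<close>. As it maps homomorphically to every realization of
  every instance of \<open>\<phi>\<close>, it decides \<open>Kn_phi\<close> alone.
\<close>

lemma (in henson_model) generic_realization:
  fixes \<phi> :: "((nat + nat) + 'a) fm"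
  assumes small: "small \<kappa> C" and bs: "set bs \<inter> C = {}" and \<phi>: "\<phi> \<in> LR k (length bs) C"
    and \<rho>0: "models R \<rho>0 (inst (nth bs) \<phi>)"
  obtains a q where "\<forall>i<k. q (a i) = i" "a ` {..<k} \<inter> (set bs \<union> C) = {}"
    "models R a (inst (nth bs) \<phi>)"
    "\<forall>\<rho> b. models R \<rho> (inst b \<phi>) \<longrightarrow> (\<forall>x \<in> a ` {..<k} \<union> C. \<forall>y \<in> a ` {..<k} \<union> C.
      R x y \<longrightarrow> R (if x \<in> C then x else \<rho> (q x)) (if y \<in> C then y else \<rho> (q y)))"
    "\<forall>\<rho> b. models R \<rho> (inst b \<phi>) \<longrightarrow> (\<forall>x \<in> a ` {..<k}. \<forall>y \<in> set bs.
      R x y \<longrightarrow> (\<exists>j<length bs. bs ! j = y \<and> R (\<rho> (q x)) (b j)))"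
proof -
  let ?c = "conjuncts \<phi>"
  have adj: "R (case_sum (case_sum \<rho> b) id s) (case_sum (case_sum \<rho> b) id t)"
    if "models R \<rho> (inst b \<phi>)" "Adj (Sym s) (Sym t) \<in> ?c" for \<rho> b s t
    using that holds_conjuncts[of R _ "[]" \<phi>] unfolding models_inst by fastforce
  have Adj_sym: "Adj s t \<in> ?c \<longleftrightarrow> Adj t s \<in> ?c" and Eq_sym: "Eq s t \<in> ?c \<longleftrightarrow> Eq t s \<in> ?c" for s t
    using \<phi> unfolding LR_def L0_def sym_closed_def by blast+
  have symm: "R u v \<longleftrightarrow> R v u" for u v using sym by blast
  \<comment> \<open>The prescribed edges at \<open>x_i\<close>. A point may stand at several
    positions of \<open>bs\<close>, and any of them may prescribe the edge.\<close>
  define e where "e i d \<longleftrightarrow> (\<exists>j<length bs. bs ! j = d \<and> Adj (xvar i) (yvar j) \<in> ?c) \<or>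
    d \<in> C \<and> Adj (xvar i) (Sym (Inr d)) \<in> ?c" for i d
  define E :: "'a + nat \<Rightarrow> 'a + nat \<Rightarrow> bool" where
    "E u v = (case (u, v) of (Inl d, Inl d') \<Rightarrow> R d d' | (Inl d, Inr i) \<Rightarrow> e i d
      | (Inr i, Inl d) \<Rightarrow> e i d | (Inr i, Inr j) \<Rightarrow> Adj (xvar i) (xvar j) \<in> ?c)" for u v
  have E: "E (Inl d) (Inl d') = R d d'" "E (Inl d) (Inr i) = e i d" "E (Inr i) (Inl d) = e i d"
    "E (Inr i) (Inr j) \<longleftrightarrow> Adj (xvar i) (xvar j) \<in> ?c" for d d' i j by (simp_all add: E_def)
  define D where "D = set bs \<union> C"
  define V where "V = Inl ` D \<union> Inr ` {..<k}"
  \<comment> \<open>Evaluation in the given realization: it sends prescribed edges to edges but may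
    identify vertices.\<close>
  define g where "g = case_sum (\<lambda>d. d) \<rho>0"
  have e_adj: "R (\<rho>0 i) d" if "e i d" for i d
    using that adj[OF \<rho>0, of "Inl (Inl i)" "Inl (Inr _)"] adj[OF \<rho>0, of "Inl (Inl i)" "Inr d"]
    unfolding e_def by auto
  have g: "R (g u) (g v)" if "E u v" for u v
    using that e_adj sym adj[OF \<rho>0, of "Inl (Inl _)" "Inl (Inl _)"]
    by (cases u; cases v) (auto simp: E g_def)
  have graph: "graph E" unfolding graph_def
  proof (intro conjI allI impI notI)
    show "E v u" if "E u v" for u v
      using that symm Adj_sym by (cases u; cases v) (auto simp: E)
    show False if "E u u" for u using g[OF that] irrefl by blast
  qed
  have free: "clique_free n V E"
    by (rule clique_freeI, rule no_clique_image[of _ g]) (use g in auto)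
  have small_V: "small \<kappa> V"
    unfolding V_def D_def by (intro small_Un small_image small small_finite) auto
  have V0: "Inl ` D \<subseteq> V" by (auto simp: V_def)
  have "partial_iso E R ((\<lambda>v. (v, projl v)) ` Inl ` D)"
    by (rule partial_isoI) (auto simp: E)
  from embedding_extension[OF small_V V0 graph free this]
  obtain f where f: "\<And>v. v \<in> Inl ` D \<Longrightarrow> f v = projl v"
    "\<And>u v. u \<in> V \<Longrightarrow> v \<in> V \<Longrightarrow> (f u = f v \<longleftrightarrow> u = v) \<and> (R (f u) (f v) \<longleftrightarrow> E u v)"
    by blast
  have f_D: "f (Inl d) = d" if "d \<in> D" for d using f(1)[of "Inl d"] that by simp
  have V: "d \<in> D \<Longrightarrow> Inl d \<in> V" "i < k \<Longrightarrow> Inr i \<in> V" for d i by (auto simp: V_def)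
  define a where "a i = f (Inr i)" for i
  define q where "q = inv_into {..<k} a"
  have "inj_on a {..<k}" by (rule inj_onI) (use f(2) V in \<open>auto simp: a_def\<close>)
  then have q: "q (a i) = i" if "i < k" for i using that by (simp add: q_def)
  have aa: "R (a i) (a j) \<longleftrightarrow> Adj (xvar i) (xvar j) \<in> ?c" if "i < k" "j < k" for i j
    using f(2)[OF V(2) V(2)] that by (simp add: a_def E)
  have ad: "a i \<noteq> d \<and> (R (a i) d \<longleftrightarrow> e i d)" if "i < k" "d \<in> D" for i d
    using f(2)[OF V(2)[OF that(1)] V(1)[OF that(2)]] f_D[OF that(2)] by (auto simp: a_def E)
  define w :: "(nat + nat) + 'a \<Rightarrow> 'a + nat" where
    "w = case_sum (case_sum Inr (\<lambda>j. Inl (bs ! j))) Inl"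
  let ?S = "({..<k} <+> {..<length bs}) <+> C"
  have w: "w s \<in> V \<and> case_sum (case_sum a (nth bs)) id s = f (w s) \<and>
    case_sum (case_sum \<rho>0 (nth bs)) id s = g (w s)" if "s \<in> ?S" for s
    using that f_D by (auto simp: w_def V_def D_def a_def g_def)
  \<comment> \<open>Negated conjuncts hold because an equality or edge of the generic graph persists
    under \<open>g\<close>, in the given realization. Positive edges are built in, and the only
    equalities that \<open>LR\<close> admits are trivial ones and those between parameters.\<close>
  have model: "models R a (inst (nth bs) \<phi>)"
    unfolding models_inst holds_conjuncts[of R _ _ \<phi>]
  proof
    fix \<psi> assume \<psi>: "\<psi> \<in> ?c"
    then have hold: "holds R (case_sum (case_sum \<rho>0 (nth bs)) id) [] \<psi>"
      using \<rho>0 holds_conjuncts unfolding models_inst by blast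
    obtain s t where st: "s \<in> ?S" "t \<in> ?S"
      and cases: "\<psi> = Eq (Sym s) (Sym t) \<or> \<psi> = Adj (Sym s) (Sym t) \<or> \<psi> = Neg (Eq (Sym s) (Sym t)) \<or>
        \<psi> = Neg (Adj (Sym s) (Sym t))"
      using LR_literal_cases[OF \<phi> \<psi>] by blast
    have fw: "f (w s) = f (w t) \<longleftrightarrow> w s = w t" "R (f (w s)) (f (w t)) \<longleftrightarrow> E (w s) (w t)"
      using f(2) w st by blast+
    note w_st = w[OF st(1)] w[OF st(2)]
    have "w s = w t" if Eq: "Eq (Sym s) (Sym t) \<in> ?c" "g (w s) = g (w t)"
    proof -
      have no_c: "Eq (Sym (Inl v)) (Sym (Inr c)) \<notin> ?c" for v c
        using \<phi> unfolding LR_def L0_def by blast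
      have no_c': "Eq (Sym (Inr c)) (Sym (Inl v)) \<notin> ?c" for v c using no_c Eq_sym by blast
      have xx: "Eq (xvar i) (xvar j) \<in> ?c \<Longrightarrow> i = j" "Eq (yvar i) (yvar j) \<in> ?c \<Longrightarrow> i = j" for i j
        using \<phi> unfolding LR_def L0_def by blast+
      have xy: "Eq (xvar i) (yvar j) \<notin> ?c" for i j using \<phi> unfolding LR_def by blast
      have yx: "Eq (yvar j) (xvar i) \<notin> ?c" for i j using xy Eq_sym by blast
      show ?thesis
        using st Eq no_c no_c' xx xy yx by (auto simp: w_def g_def)
    qed
    moreover have "E (w s) (w t)" if "Adj (Sym s) (Sym t) \<in> ?c" "R (g (w s)) (g (w t))"
    proof -
      have "Adj (Sym t) (Sym s) \<in> ?c" using that Adj_sym by blast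
      with that show ?thesis using st by (auto simp: w_def g_def E e_def)
    qed
    ultimately show "holds R (case_sum (case_sum a (nth bs)) id) [] \<psi>"
      using cases hold w_st fw g[of "w s" "w t"] \<psi> by (elim disjE) auto
  qed
  have disj: "a ` {..<k} \<inter> (set bs \<union> C) = {}" using ad by (auto simp: D_def)
  have hom_AC: "R (if x \<in> C then x else \<rho> (q x)) (if y \<in> C then y else \<rho> (q y))"
    if \<rho>: "models R \<rho> (inst b \<phi>)" and xy: "x \<in> a ` {..<k} \<union> C" "y \<in> a ` {..<k} \<union> C" "R x y" for \<rho> b x y
  proof -
    have C: "R (\<rho> i) c" if "i < k" "c \<in> C" "R (a i) c" for i c
    proof -
      have "e i c" using ad[of i c] that by (simp add: D_def)
      moreover have "c \<notin> set bs" using that bs by blast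
      ultimately have "Adj (xvar i) (Sym (Inr c)) \<in> ?c" unfolding e_def by auto
      from adj[OF \<rho> this] show ?thesis by simp
    qed
    have A: "R (\<rho> i) (\<rho> j)" if "i < k" "j < k" "R (a i) (a j)" for i j
      using adj[OF \<rho>, of "Inl (Inl i)" "Inl (Inl j)"] aa that by simp
    have aC: "a i \<notin> C" if "i < k" for i using ad[OF that] by (auto simp: D_def)
    consider "x \<in> C" "y \<in> C" | j where "x \<in> C" "y = a j" "j < k" | i where "x = a i" "i < k" "y \<in> C"
      | i j where "x = a i" "i < k" "y = a j" "j < k" using xy by blast
    then show ?thesis
      by cases (use xy(3) aC q C[of _ x] C[of _ y] A symm in auto)
  qed
  have hom_b: "\<exists>j<length bs. bs ! j = y \<and> R (\<rho> (q x)) (b j)"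
    if \<rho>: "models R \<rho> (inst b \<phi>)" and xy: "x \<in> a ` {..<k}" "y \<in> set bs" "R x y" for \<rho> b x y
  proof -
    obtain i where i: "x = a i" "i < k" using xy by blast
    then have "e i y" using ad[of i y] xy by (simp add: D_def)
    moreover have "y \<notin> C" using bs xy by blast
    ultimately obtain j where j: "j < length bs" "bs ! j = y" "Adj (xvar i) (yvar j) \<in> ?c"
      unfolding e_def by blast
    from adj[OF \<rho> j(3)] show ?thesis using j i q by auto
  qed
  show thesis
  proof (rule that[of q a])
    show "\<forall>i<k. q (a i) = i" using q by simp
    show "\<forall>\<rho> b. models R \<rho> (inst b \<phi>) \<longrightarrow> (\<forall>x \<in> a ` {..<k} \<union> C. \<forall>y \<in> a ` {..<k} \<union> C.
      R x y \<longrightarrow> R (if x \<in> C then x else \<rho> (q x)) (if y \<in> C then y else \<rho> (q y)))"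
      by (intro allI impI ballI) (rule hom_AC)
    show "\<forall>\<rho> b. models R \<rho> (inst b \<phi>) \<longrightarrow> (\<forall>x \<in> a ` {..<k}. \<forall>y \<in> set bs.
      R x y \<longrightarrow> (\<exists>j<length bs. bs ! j = y \<and> R (\<rho> (q x)) (b j)))"
      by (intro allI impI ballI) (rule hom_b)
  qed (rule disj model)+
qed

section \<open>Dividing\<close>

lemma (in henson_model) divides_if_conjunct_eq:
  assumes small: "small \<kappa> C" and bs: "set bs \<inter> C = {}"
    and conj: "has_conjunct_eq \<phi> bs i b"
  shows "divides R C {..<length bs} {\<phi>} (nth bs)"
proof -
  obtain j where j: "j < length bs" "Eq (xvar i) (yvar j) \<in> conjuncts \<phi>"
    using conj unfolding has_conjunct_eq_def by blast
  \<comment> \<open>Crossing along the empty set adds no edges: the copies are merely disjoint, and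
    two instances already ask \<open>x_i\<close> to equal two different points.\<close>
  obtain s where s: "crossed_copies R {} (set bs) C s"
    using crossed_copies_exist[OF small_finite[OF finite_set] small bs, of "{}"] n_pos not_Kn_empty
    by auto
  have "indiscernible R C {..<length bs} (\<lambda>l j. s l (bs ! j))"
    by (rule crossed_copies_indiscernible[OF s]) auto
  moreover have "\<forall>j\<in>{..<length bs}. s 0 (bs ! j) = bs ! j" using crossed_copiesD(1)[OF s] by simp
  moreover have "\<not> consistent R (\<Union>l. inst (\<lambda>j. s l (bs ! j)) ` {\<phi>})"
  proof (rule not_consistentI[of "(\<lambda>l. inst (\<lambda>j. s l (bs ! j)) \<phi>) ` {0, 1}"])
    fix \<rho> assume *: "\<And>\<psi>. \<psi> \<in> (\<lambda>l. inst (\<lambda>j. s l (bs ! j)) \<phi>) ` {0, 1} \<Longrightarrow> models R \<rho> \<psi>"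
    have "\<rho> i = s l (bs ! j)" if "l \<in> {0, 1}" for l
    proof -
      have "models R \<rho> (inst (\<lambda>j. s l (bs ! j)) \<phi>)" using * that by blast
      then have "holds R (case_sum (case_sum \<rho> (\<lambda>j. s l (bs ! j))) id) [] (Eq (xvar i) (yvar j))"
        using holds_conjuncts j(2) unfolding models_inst by blast
      then show ?thesis by simp
    qed
    then have "s 0 (bs ! j) = s 1 (bs ! j)" by (metis insertCI)
    then show False using crossed_copiesD(5)[OF s, of "bs ! j" "bs ! j" 0 1] j(1) by simp
  qed auto
  ultimately show ?thesis unfolding divides_def by blast
qed

text \<open>The generic \<open>a\<close> has a witness \<open>B1\<close>, \<open>T\<close> of
  \<open>Kn\<close>, whose edges pass by homomorphism to all realizations of all instances. A common
  realization over copies crossed along \<open>B1\<close> would thus complete a transversal to a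
  clique of size \<open>n\<close>.\<close>

lemma (in henson_model) divides_if_Kn_phi:
  assumes small: "small \<kappa> C" and bs: "set bs \<inter> C = {}" and \<phi>: "\<phi> \<in> LR k (length bs) C"
    and \<rho>0: "models R \<rho>0 (inst (nth bs) \<phi>)" and Kn: "Kn_phi R n k \<phi> bs C"
  shows "divides R C {..<length bs} {\<phi>} (nth bs)"
proof -
  obtain B where B: "B \<subseteq> set bs" "\<not> Kn R n B C"
    "\<And>as. length as = k \<Longrightarrow> models R (nth as) (inst (nth bs) \<phi>) \<Longrightarrow> Kn R n B ((set as \<union> C) - B)"
    using Kn unfolding Kn_phi_def by blast
  obtain a q where a: "\<forall>i<k. q (a i) = i" "a ` {..<k} \<inter> (set bs \<union> C) = {}"
    "models R a (inst (nth bs) \<phi>)"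
    and hom: "\<forall>\<rho> b. models R \<rho> (inst b \<phi>) \<longrightarrow> (\<forall>x \<in> a ` {..<k} \<union> C. \<forall>y \<in> a ` {..<k} \<union> C.
      R x y \<longrightarrow> R (if x \<in> C then x else \<rho> (q x)) (if y \<in> C then y else \<rho> (q y)))"
    "\<forall>\<rho> b. models R \<rho> (inst b \<phi>) \<longrightarrow> (\<forall>x \<in> a ` {..<k}. \<forall>y \<in> set bs.
      R x y \<longrightarrow> (\<exists>j<length bs. bs ! j = y \<and> R (\<rho> (q x)) (b j)))"
    by (rule generic_realization[OF small bs \<phi> \<rho>0])
  \<comment> \<open>\<open>Kn_phi\<close> speaks of lists; from \<open>k\<close> on the list and
    \<open>a\<close> may differ, but \<phi> mentions only variables below \<open>k\<close>.\<close>
  have "models R (nth (map a [0..<k])) (inst (nth bs) \<phi>)"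
    unfolding models_inst
  proof -
    let ?\<sigma> = "case_sum (case_sum a (nth bs)) id"
      and ?\<tau> = "case_sum (case_sum (nth (map a [0..<k])) (nth bs)) id"
    have lang: "wf_fm 0 \<phi>" "syms \<phi> \<subseteq> ({..<k} <+> {..<length bs}) <+> C"
      using \<phi> by (auto simp: LR_def L0_def lang_def)
    have "?\<tau> u = ?\<sigma> u" if "u \<in> syms \<phi>" for u
      using subsetD[OF lang(2) that] by auto
    then have "holds R ?\<tau> [] \<phi> \<longleftrightarrow> holds R ?\<sigma> [] \<phi>"
      by (intro holds_partial_iso_map[OF lang(1)]) metis
    then show "holds R ?\<tau> [] \<phi>" using a(3) by (simp add: models_inst)
  qed
  then have "Kn R n B ((a ` {..<k} \<union> C) - B)"
    using B(3)[of "map a [0..<k]"] by (simp add: atLeast0LessThan)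
  then obtain B1 T where B1: "B1 \<subseteq> B" "T \<subseteq> (a ` {..<k} \<union> C) - B" "finite B1" "finite T" "B1 \<noteq> {}" "T \<noteq> {}"
    "card B1 + card T = n" "\<forall>u\<in>T. \<forall>v\<in>T. u \<noteq> v \<longrightarrow> R u v"
    "\<forall>u\<in>B1. \<forall>v\<in>T. R u v"
    by (rule Kn_cases) blast
  have "\<not> Kn R n B1 C" using Kn_mono[of R n B1 C B] B B1(1) bs by blast
  moreover have "card B1 < n" using B1 card_gt_0_iff[of T] by linarith
  moreover have "B1 \<subseteq> set bs" using B1 B by blast
  ultimately obtain s where s: "crossed_copies R B1 (set bs) C s"
    using crossed_copies_exist[OF small_finite[OF finite_set] small bs, of B1] B1(3) by blast
  have "indiscernible R C {..<length bs} (\<lambda>l j. s l (bs ! j))"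
    by (rule crossed_copies_indiscernible[OF s]) auto
  moreover have "\<forall>j\<in>{..<length bs}. s 0 (bs ! j) = bs ! j" using crossed_copiesD(1)[OF s] by simp
  moreover have "\<not> consistent R (\<Union>l. inst (\<lambda>j. s l (bs ! j)) ` {\<phi>})"
  proof (rule not_consistentI[of "(\<lambda>l. inst (\<lambda>j. s l (bs ! j)) \<phi>) ` {..<card B1}"])
    fix \<rho> assume *: "\<And>\<psi>. \<psi> \<in> (\<lambda>l. inst (\<lambda>j. s l (bs ! j)) \<phi>) ` {..<card B1} \<Longrightarrow> models R \<rho> \<psi>"
    have model: "models R \<rho> (inst (\<lambda>j. s l (bs ! j)) \<phi>)" if "l < card B1" for l using * that by blast
    have pos: "0 < card B1" using B1 by (simp add: card_gt_0_iff)
    show False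
    proof (rule crossed_copies_no_clique[OF s \<open>B1 \<subseteq> set bs\<close> B1(3,4,7), of "\<lambda>x. if x \<in> C then x else \<rho> (q x)"])
      fix x y assume "x \<in> T" "y \<in> T" "x \<noteq> y"
      then show "R (if x \<in> C then x else \<rho> (q x)) (if y \<in> C then y else \<rho> (q y))"
        using hom(1)[rule_format, OF model[OF pos], of x y] B1(2,8) by blast
    next
      fix x y l assume xy: "x \<in> T" "y \<in> B1" "l < card B1"
      have adj: "R y x" using B1(9) xy by blast
      have y: "y \<in> set bs" using xy \<open>B1 \<subseteq> set bs\<close> by blast
      show "R (if x \<in> C then x else \<rho> (q x)) (s l y)"
      proof (cases "x \<in> C")
        case True
        then show ?thesis using crossed_copiesD(4)[OF s y True] adj sym by simp
      next
        case False
        then have "x \<in> a ` {..<k}" using xy B1(2) by blast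
        from hom(2)[rule_format, OF model[OF xy(3)] this y sym[OF adj]] show ?thesis using False by auto
      qed
    qed
  qed auto
  ultimately show ?thesis unfolding divides_def by blast
qed

text \<open>If \<open>Kn_phi\<close> fails, the generic \<open>a\<close> meets the hypothesis of
  \<open>copies_realization\<close>: a bad \<open>B1\<close> would come with a realization
  \<open>as\<close> that has no witness of \<open>Kn\<close>, yet the homomorphism from
  \<open>a\<close> to \<open>as\<close> produces one.\<close>

lemma (in henson_model) Kn_phi_if_divides:
  assumes small: "small \<kappa> C" and bs: "set bs \<inter> C = {}" and \<phi>: "\<phi> \<in> LR k (length bs) C"
    and \<rho>0: "models R \<rho>0 (inst (nth bs) \<phi>)"
    and div: "divides R C {..<length bs} {\<phi>} (nth bs)"
  shows "Kn_phi R n k \<phi> bs C"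
proof (rule ccontr)
  assume no: "\<not> Kn_phi R n k \<phi> bs C"
  obtain s where ind: "indiscernible R C {..<length bs} s" and s0: "\<forall>j\<in>{..<length bs}. s 0 j = bs ! j"
    and incons: "\<not> consistent R (\<Union>l. inst (s l) ` {\<phi>})"
    using div unfolding divides_def by blast
  obtain a q where a: "\<forall>i<k. q (a i) = i" "a ` {..<k} \<inter> (set bs \<union> C) = {}"
    "models R a (inst (nth bs) \<phi>)"
    and hom: "\<forall>\<rho> b. models R \<rho> (inst b \<phi>) \<longrightarrow> (\<forall>x \<in> a ` {..<k} \<union> C. \<forall>y \<in> a ` {..<k} \<union> C.
      R x y \<longrightarrow> R (if x \<in> C then x else \<rho> (q x)) (if y \<in> C then y else \<rho> (q y)))"
    "\<forall>\<rho> b. models R \<rho> (inst b \<phi>) \<longrightarrow> (\<forall>x \<in> a ` {..<k}. \<forall>y \<in> set bs.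
      R x y \<longrightarrow> (\<exists>j<length bs. bs ! j = y \<and> R (\<rho> (q x)) (b j)))"
    by (rule generic_realization[OF small bs \<phi> \<rho>0])
  let ?A = "a ` {..<k}"
  have range: "nth bs ` {..<length bs} = set bs" by (auto simp: in_set_conv_nth)
  obtain t where t: "copies R C (set bs) t"
    "\<And>l j. j \<in> {..<length bs} \<Longrightarrow> bs ! j \<in> set bs \<Longrightarrow> t l (bs ! j) = s l j"
    using copies_of_indiscernible[OF ind, of "nth bs" "set bs"] s0 bs range by blast
  have "Kn R n B' C" if B': "finite B'" "B' \<subseteq> set bs" "Kn R n B' (?A \<union> C)" for B'
  proof (rule ccontr)
    assume contr: "\<not> Kn R n B' C"
    have "B' \<inter> (?A \<union> C) = {}" using a(2) bs B'(2) by blast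
    then obtain B1 T where B1: "B1 \<subseteq> B'" "T \<subseteq> ?A \<union> C" "finite B1" "finite T" "B1 \<noteq> {}" "T \<noteq> {}"
      "card B1 + card T = n" "\<forall>u\<in>T. \<forall>v\<in>T. u \<noteq> v \<longrightarrow> R u v"
      "\<forall>u\<in>B1. \<forall>v\<in>T. R u v"
      by (rule Kn_cases[OF B'(3)])
    have B1bs: "B1 \<subseteq> set bs" using B1 B' by blast
    have "\<not> Kn R n B1 C" using Kn_mono[of R n B1 C B'] contr B' B1(1) bs by blast
    moreover have "0 < card B1" "0 < card T" using B1 by (auto simp: card_gt_0_iff)
    then have "0 < card B1" "card B1 < n" using B1(7) by linarith+
    ultimately obtain as where as: "length as = k" "models R (nth as) (inst (nth bs) \<phi>)"
      "\<not> Kn R n B1 ((set as \<union> C) - B1)"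
      using no B1bs unfolding Kn_phi_def by blast
    define g where "g x = (if x \<in> C then x else as ! q x)" for x
    have g_adj: "R (g x) (g y)" if "x \<in> T" "y \<in> T" "x \<noteq> y" for x y
      unfolding g_def using hom(1)[rule_format, OF as(2), of x y] B1(2,8) that by blast
    have g_B: "R y (g x)" if "x \<in> T" "y \<in> B1" for x y
    proof (cases "x \<in> C")
      case True
      then show ?thesis using B1(9) that by (simp add: g_def)
    next
      case False
      then have "x \<in> ?A" using that B1(2) by blast
      moreover have "y \<in> set bs" using that B1bs by blast
      moreover have "R x y" using B1(9) that sym by blast
      ultimately have "R (as ! q x) y" using hom(2)[rule_format, OF as(2)] by blast
      then show ?thesis using False sym by (simp add: g_def)
    qed
    have inj: "inj_on g T" using g_adj irrefl by (metis inj_onI)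
    have "Kn R n B1 ((set as \<union> C) - B1)"
    proof (rule KnI[of _ _ B1 "g ` T"])
      have "g x \<in> set as \<union> C" if "x \<in> T" for x
        using subsetD[OF B1(2) that] a(1) as(1) by (auto simp: g_def)
      \<comment> \<open>\<open>g x\<close> is adjacent to all of \<open>B1\<close>, so irreflexivity
        keeps it outside \<open>B1\<close>, which \<open>Kn_phi\<close> removes.\<close>
      moreover have "g x \<notin> B1" if "x \<in> T" for x using g_B[OF that] irrefl by blast
      ultimately show "g ` T \<subseteq> set as \<union> C - B1" by blast
      show "card B1 + card (g ` T) = n" using inj B1(7) by (simp add: card_image)
      show "R u v" if uv: "u \<in> g ` T" "v \<in> g ` T" "u \<noteq> v" for u v
      proof -
        obtain x y where "u = g x" "v = g y" "x \<in> T" "y \<in> T" using uv by blast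
        then show ?thesis using g_adj uv(3) by blast
      qed
    qed (use B1 g_B in auto)
    then show False using as(3) by blast
  qed
  note Kn = this
  have A: "?A \<inter> set bs = {}" using a(2) by blast
  have small_A: "small \<kappa> ?A" by (rule small_finite) simp
  obtain \<rho> where \<rho>: "\<And>c. c \<in> C \<Longrightarrow> \<rho> c = c"
    "\<And>l u v. u \<in> ?A \<union> set bs \<union> C \<Longrightarrow> v \<in> ?A \<union> set bs \<union> C \<Longrightarrow>
      ((if u \<in> set bs then t l u else \<rho> u) = (if v \<in> set bs then t l v else \<rho> v) \<longleftrightarrow> u = v) \<and>
      (R (if u \<in> set bs then t l u else \<rho> u) (if v \<in> set bs then t l v else \<rho> v) \<longleftrightarrow> R u v)"
    using copies_realization[OF small_A small_finite[OF finite_set] small A bs t(1) Kn] by blast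
  have "models R (\<lambda>i. \<rho> (a i)) (inst (s l) \<phi>)" for l
  proof -
    have lang: "wf_fm 0 \<phi>" "syms \<phi> \<subseteq> ({..<k} <+> {..<length bs}) <+> C"
      using \<phi> by (auto simp: LR_def L0_def lang_def)
    let ?\<sigma> = "case_sum (case_sum a (nth bs)) id"
      and ?\<tau> = "case_sum (case_sum (\<lambda>i. \<rho> (a i)) (s l)) id"
    have mem: "?\<sigma> u \<in> ?A \<union> set bs \<union> C" if "u \<in> syms \<phi>" for u
      using subsetD[OF lang(2) that] by auto
    have val: "?\<tau> u = (if ?\<sigma> u \<in> set bs then t l (?\<sigma> u) else \<rho> (?\<sigma> u))"
      if "u \<in> syms \<phi>" for u
      using subsetD[OF lang(2) that] t(2)[of _ l] \<rho>(1) A bs by auto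
    have "holds R ?\<tau> [] \<phi> \<longleftrightarrow> holds R ?\<sigma> [] \<phi>"
    proof (rule holds_partial_iso_map[OF lang(1)])
      fix u v assume uv: "u \<in> syms \<phi>" "v \<in> syms \<phi>"
      show "(?\<tau> u = ?\<tau> v \<longleftrightarrow> ?\<sigma> u = ?\<sigma> v) \<and>
        (R (?\<tau> u) (?\<tau> v) \<longleftrightarrow> R (?\<sigma> u) (?\<sigma> v))"
        unfolding val[OF uv(1)] val[OF uv(2)] by (rule \<rho>(2)[OF mem[OF uv(1)] mem[OF uv(2)]])
    qed
    then show ?thesis using a(3) by (simp add: models_inst)
  qed
  then have "consistent R (\<Union>l. inst (s l) ` {\<phi>})" unfolding consistent_def by blast
  then show False using incons by blast
qed

lemma (in henson_model) formula_divides_iff: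
  assumes small: "small \<kappa> C" and bs: "set bs \<inter> C = {}" and \<phi>: "\<phi> \<in> L0 k (length bs) C"
    and cons: "consistent R {inst (nth bs) \<phi>}"
  shows "divides R C {..<length bs} {\<phi>} (nth bs) \<longleftrightarrow>
    (\<exists>i. \<exists>b\<in>set bs. has_conjunct_eq \<phi> bs i b) \<or> (\<phi> \<in> LR k (length bs) C \<and> Kn_phi R n k \<phi> bs C)"
proof -
  obtain \<rho>0 where \<rho>0: "models R \<rho>0 (inst (nth bs) \<phi>)"
    using cons unfolding consistent_def by blast
  have "\<phi> \<in> LR k (length bs) C" if no: "\<not> (\<exists>i. \<exists>b\<in>set bs. has_conjunct_eq \<phi> bs i b)"
    unfolding LR_def
  proof (intro CollectI conjI \<phi> allI notI)
    fix i j assume eq: "Eq (xvar i) (yvar j) \<in> conjuncts \<phi>"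
    have "wf_fm 0 \<phi>" "syms \<phi> \<subseteq> ({..<k} <+> {..<length bs}) <+> C"
      using \<phi> by (auto simp: L0_def lang_def)
    then have "j < length bs" using conjuncts_wf[OF eq] by auto
    then have "has_conjunct_eq \<phi> bs i (bs ! j)" using eq unfolding has_conjunct_eq_def by blast
    then show False using no nth_mem[OF \<open>j < length bs\<close>] by blast
  qed
  then show ?thesis
    using divides_if_conjunct_eq[OF small bs] divides_if_Kn_phi[OF small bs _ \<rho>0]
      Kn_phi_if_divides[OF small bs _ \<rho>0] by blast
qed

section \<open>Independence of sets\<close>

definition full_type :: "('a \<Rightarrow> 'a \<Rightarrow> bool) \<Rightarrow> 'a set \<Rightarrow> 'a set \<Rightarrow> (('a + 'a) + 'a) fm set" where
  "full_type R A D = {\<phi> \<in> lang (A <+> D) {}. inst id \<phi> \<in> tp R A D}"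

lemma full_type_iff:
  "\<phi> \<in> full_type R A D \<longleftrightarrow> \<phi> \<in> lang (A <+> D) {} \<and> holds R (case_sum (case_sum id id) id) [] \<phi>"
proof -
  have wf: "wf_fm k (map_fm f \<phi>) \<longleftrightarrow> wf_fm k \<phi>" for k and f :: "('a + 'a) + 'a \<Rightarrow> 'a + 'a"
  proof (induction \<phi> arbitrary: k)
    have "wf_tm k (map_tm f t) \<longleftrightarrow> wf_tm k t" for k t by (cases t) auto
    then show "wf_fm k (map_fm f (Eq s t)) \<longleftrightarrow> wf_fm k (Eq s t)"
      "wf_fm k (map_fm f (Adj s t)) \<longleftrightarrow> wf_fm k (Adj s t)" for k s t by auto
  qed auto
  have "inst id \<phi> \<in> lang A D" if "\<phi> \<in> lang (A <+> D) {}"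
    using that unfolding lang_def inst_def by (auto simp: wf fm.set_map)
  then show ?thesis by (auto simp: full_type_def tp_def models_inst)
qed

text \<open>A common point outside \<open>C\<close> puts an equation between an x-variable and a
  y-variable into the type, which cannot hold over two disjoint copies of
  \<open>B - C\<close>.\<close>

lemma (in henson_model) disjoint_if_indep_d:
  assumes small: "small \<kappa> B" "small \<kappa> C"
    and nodiv: "\<not> divides R C (B \<union> C) (full_type R A (B \<union> C)) id"
  shows "A \<inter> B \<subseteq> C"
proof (rule ccontr)
  assume "\<not> A \<inter> B \<subseteq> C"
  then obtain x where x: "x \<in> A" "x \<in> B" "x \<notin> C" by blast
  obtain s where s: "crossed_copies R {} (B - C) C s"
    using crossed_copies_exist[OF small_subset[OF small(1), of "B - C"] small(2), of "{}"] n_pos not_Kn_empty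
    by auto
  define \<phi> :: "(('a + 'a) + 'a) fm" where "\<phi> = Eq (Sym (Inl (Inl x))) (Sym (Inl (Inr x)))"
  have "\<phi> \<in> full_type R A (B \<union> C)" using x by (auto simp: full_type_iff \<phi>_def lang_def)
  then have "\<not> consistent R (\<Union>l. inst (s l) ` full_type R A (B \<union> C))"
  proof (intro not_consistentI[of "{inst (s 0) \<phi>, inst (s 1) \<phi>}"])
    fix \<rho> assume "\<And>\<psi>. \<psi> \<in> {inst (s 0) \<phi>, inst (s 1) \<phi>} \<Longrightarrow> models R \<rho> \<psi>"
    then have "models R \<rho> (inst (s 0) \<phi>)" "models R \<rho> (inst (s 1) \<phi>)" by auto
    then have "s 0 x = s 1 x" by (simp add: models_inst \<phi>_def)
    then show False using crossed_copiesD(5)[OF s, of x x 0 1] x by simp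
  qed auto
  moreover have "indiscernible R C (B \<union> C) (\<lambda>l j. s l (id j))"
    by (rule crossed_copies_indiscernible[OF s]) auto
  moreover have "\<forall>j\<in>B \<union> C. s 0 j = id j" using crossed_copiesD(1,2)[OF s] by auto
  ultimately show False using nodiv unfolding divides_def by auto
qed

text \<open>The type of \<open>A\<close> contains all edges of a witness \<open>B1\<close>,
  \<open>T\<close>, hence forces them over every member; these finitely many formulas are
  inconsistent over \<open>card B1\<close> crossed copies.\<close>

lemma (in henson_model) Kn_if_indep_d:
  assumes small: "small \<kappa> B" "small \<kappa> C" and AB: "A \<inter> B \<subseteq> C"
    and nodiv: "\<not> divides R C (B \<union> C) (full_type R A (B \<union> C)) id"
    and B': "B' \<subseteq> B - C" and Kn: "Kn R n B' (A \<union> C)"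
  shows "Kn R n B' C"
proof (rule ccontr)
  assume contr: "\<not> Kn R n B' C"
  have "B' \<inter> (A \<union> C) = {}" using AB B' by blast
  then obtain B1 T where B1: "B1 \<subseteq> B'" "T \<subseteq> A \<union> C" "finite B1" "finite T" "B1 \<noteq> {}" "T \<noteq> {}"
    "card B1 + card T = n" "\<forall>u\<in>T. \<forall>v\<in>T. u \<noteq> v \<longrightarrow> R u v"
    "\<forall>u\<in>B1. \<forall>v\<in>T. R u v"
    by (rule Kn_cases[OF Kn])
  have pos: "0 < card B1" "0 < card T" using B1 by (auto simp: card_gt_0_iff)
  have B1B: "B1 \<subseteq> B - C" using B1 B' by blast
  have "\<not> Kn R n B1 C" using Kn_mono[of R n B1 C B'] contr B' B1(1) by blast
  then obtain s where s: "crossed_copies R B1 (B - C) C s"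
    using crossed_copies_exist[OF small_subset[OF small(1), of "B - C"] small(2), of B1] B1 B1B pos
    by auto
  \<comment> \<open>Points of \<open>A\<close> become x-variables, all others y-variables. A
    realization may move a point of \<open>A \<inter> C\<close>, but \<open>F\<close> keeps its
    edges.\<close>
  define w :: "'a \<Rightarrow> ('a + 'a) + 'a" where "w x = Inl (if x \<in> A then Inl x else Inr x)" for x
  define F where "F = {Adj (Sym (w x)) (Sym (w y)) | x y. x \<in> T \<union> B1 \<and> y \<in> T \<union> B1 \<and> R x y}"
  have "F \<subseteq> (\<lambda>(x, y). Adj (Sym (w x)) (Sym (w y))) ` ((T \<union> B1) \<times> (T \<union> B1))" by (auto simp: F_def)
  then have fin: "finite F" by (rule finite_subset) (use B1 in auto)
  have F: "F \<subseteq> full_type R A (B \<union> C)"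
    using B1(2) B1B by (auto simp: F_def full_type_iff lang_def w_def)
  have "\<not> consistent R (\<Union>l. inst (s l) ` full_type R A (B \<union> C))"
  proof (rule not_consistentI[of "\<Union>l<card B1. inst (s l) ` F"])
    fix \<rho> assume *: "\<And>\<psi>. \<psi> \<in> (\<Union>l<card B1. inst (s l) ` F) \<Longrightarrow> models R \<rho> \<psi>"
    define z where "z l x = (if x \<in> A then \<rho> x else s l x)" for l x
    have z: "R (z l x) (z l y)" if "l < card B1" "x \<in> T \<union> B1" "y \<in> T \<union> B1" "R x y" for l x y
    proof -
      have "Adj (Sym (w x)) (Sym (w y)) \<in> F" using that unfolding F_def by blast
      then have "models R \<rho> (inst (s l) (Adj (Sym (w x)) (Sym (w y))))" using * that(1) by blast
      then show ?thesis by (auto simp: models_inst w_def z_def split: if_splits)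
    qed
    \<comment> \<open>Points of \<open>T\<close> outside \<open>A\<close> lie in \<open>C\<close>,
      which every \<open>s l\<close> fixes, so one value serves for all copies.\<close>
    have z_T: "z l x = z 0 x" if "x \<in> T" for l x
      using that B1(2) crossed_copiesD(2)[OF s] by (auto simp: z_def)
    have z_B: "z l x = s l x" if "x \<in> B1" for l x
      using that B1B AB by (auto simp: z_def)
    show False
    proof (rule crossed_copies_no_clique[OF s B1B B1(3,4,7), of "z 0"])
      show "R (z 0 x) (z 0 y)" if "x \<in> T" "y \<in> T" "x \<noteq> y" for x y
        using z[OF pos(1)] B1(8) that by blast
      show "R (z 0 x) (s l y)" if "x \<in> T" "y \<in> B1" "l < card B1" for x y l
        using z[OF that(3), of x y] B1(9) sym[of y x] z_T[of x l] z_B[of y l] that by auto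
    qed
  qed (use fin F in auto)
  moreover have "indiscernible R C (B \<union> C) (\<lambda>l j. s l (id j))"
    by (rule crossed_copies_indiscernible[OF s]) auto
  moreover have "\<forall>j\<in>B \<union> C. s 0 j = id j" using crossed_copiesD(1,2)[OF s] by auto
  ultimately show False using nodiv unfolding divides_def by auto
qed

text \<open>The single map \<rho> preserves equalities and edges together with every
  \<open>t l\<close>, so it realizes the whole type over all members at once.\<close>

lemma (in henson_model) indep_d_if_Kn:
  assumes small: "small \<kappa> A" "small \<kappa> B" "small \<kappa> C" and AB: "A \<inter> B \<subseteq> C"
    and Kn: "\<And>B'. finite B' \<Longrightarrow> B' \<subseteq> B - C \<Longrightarrow> Kn R n B' (A \<union> C) \<Longrightarrow> Kn R n B' C"
  shows "\<not> divides R C (B \<union> C) (full_type R A (B \<union> C)) id"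
proof
  assume "divides R C (B \<union> C) (full_type R A (B \<union> C)) id"
  then obtain s where ind: "indiscernible R C (B \<union> C) s" and s0: "\<And>j. j \<in> B \<union> C \<Longrightarrow> s 0 j = id j"
    and incons: "\<not> consistent R (\<Union>l. inst (s l) ` full_type R A (B \<union> C))"
    unfolding divides_def by blast
  \<comment> \<open>The formula equating the entry \<open>c\<close> with the parameter
    \<open>c\<close> is over \<open>C\<close>, so these entries are constant.\<close>
  have sC: "s l c = c" if "c \<in> C" for l c
    using indiscernible_single(3)[OF ind, of c c c l] s0[of c] that by simp
  have sub: "B - C \<subseteq> id ` (B \<union> C)" "(B - C) \<inter> C = {}" by auto
  obtain t where t: "copies R C (B - C) t"
    "\<And>l j. j \<in> B \<union> C \<Longrightarrow> id j \<in> B - C \<Longrightarrow> t l (id j) = s l j"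
    using copies_of_indiscernible[OF ind s0 sub] by blast
  have AB': "A \<inter> (B - C) = {}" using AB by blast
  obtain \<rho> where \<rho>: "\<And>c. c \<in> C \<Longrightarrow> \<rho> c = c"
    "\<And>l u v. u \<in> A \<union> (B - C) \<union> C \<Longrightarrow> v \<in> A \<union> (B - C) \<union> C \<Longrightarrow>
      ((if u \<in> B - C then t l u else \<rho> u) = (if v \<in> B - C then t l v else \<rho> v) \<longleftrightarrow> u = v) \<and>
      (R (if u \<in> B - C then t l u else \<rho> u) (if v \<in> B - C then t l v else \<rho> v) \<longleftrightarrow> R u v)"
    using copies_realization[OF small(1) small_subset[OF small(2), of "B - C"] small(3) AB' sub(2) t(1) Kn]
    by blast
  have "models R \<rho> (inst (s l) \<phi>)" if \<phi>: "\<phi> \<in> full_type R A (B \<union> C)" for l \<phi>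
  proof -
    have lang: "wf_fm 0 \<phi>" "syms \<phi> \<subseteq> (A <+> (B \<union> C)) <+> {}"
      and hold: "holds R (case_sum (case_sum id id) id) [] \<phi>"
      using \<phi> by (auto simp: full_type_iff lang_def)
    let ?\<sigma> = "case_sum (case_sum id id) id" and ?\<tau> = "case_sum (case_sum \<rho> (s l)) id"
    have mem: "?\<sigma> u \<in> A \<union> (B - C) \<union> C" if "u \<in> syms \<phi>" for u
      using subsetD[OF lang(2) that] by auto
    have val: "?\<tau> u = (if ?\<sigma> u \<in> B - C then t l (?\<sigma> u) else \<rho> (?\<sigma> u))"
      if "u \<in> syms \<phi>" for u
      using subsetD[OF lang(2) that] t(2)[of _ l] \<rho>(1) AB sC by auto
    have "holds R ?\<tau> [] \<phi> \<longleftrightarrow> holds R ?\<sigma> [] \<phi>"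
    proof (rule holds_partial_iso_map[OF lang(1)])
      fix u v assume uv: "u \<in> syms \<phi>" "v \<in> syms \<phi>"
      show "(?\<tau> u = ?\<tau> v \<longleftrightarrow> ?\<sigma> u = ?\<sigma> v) \<and>
        (R (?\<tau> u) (?\<tau> v) \<longleftrightarrow> R (?\<sigma> u) (?\<sigma> v))"
        unfolding val[OF uv(1)] val[OF uv(2)] by (rule \<rho>(2)[OF mem[OF uv(1)] mem[OF uv(2)]])
    qed
    then show ?thesis using hold by (simp add: models_inst)
  qed
  then have "consistent R (\<Union>l. inst (s l) ` full_type R A (B \<union> C))"
    unfolding consistent_def by blast
  then show False using incons by blast
qed

text \<open>Lists represent exactly the finite subsets of \<open>B - C\<close>, and these are all
  that \<open>copies_realization\<close> examines.\<close>

lemma (in henson_model) indep_d_iff: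
  assumes small: "small \<kappa> A" "small \<kappa> B" "small \<kappa> C"
  shows "indep_d R A C B \<longleftrightarrow> A \<inter> B \<subseteq> C \<and>
    (\<forall>bs. set bs \<subseteq> B - C \<and> Kn R n (set bs) (A \<union> C) \<longrightarrow> Kn R n (set bs) C)"
proof -
  have "indep_d R A C B \<longleftrightarrow> \<not> divides R C (B \<union> C) (full_type R A (B \<union> C)) id"
    unfolding indep_d_def full_type_def by (rule refl)
  moreover have "Kn R n B' C" if "\<forall>bs. set bs \<subseteq> B - C \<and> Kn R n (set bs) (A \<union> C) \<longrightarrow> Kn R n (set bs) C"
    "finite B'" "B' \<subseteq> B - C" "Kn R n B' (A \<union> C)" for B'
    using that finite_list[of B'] by blast
  ultimately show ?thesis
    using disjoint_if_indep_d[OF small(2,3)] Kn_if_indep_d[OF small(2,3)] indep_d_if_Kn[OF small]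
    by metis
qed

theorem theorem4p6:
  fixes n :: nat and \<kappa> :: "'k rel" and R :: "'a \<Rightarrow> 'a \<Rightarrow> bool"
  assumes "n \<ge> 3" and "henson_monster n \<kappa> R"
  shows
    "(\<forall>C k bs \<phi>.
        small \<kappa> C \<and> set bs \<inter> C = {} \<and> \<phi> \<in> L0 k (length bs) C \<and>
        consistent R {inst (nth bs) \<phi>} \<longrightarrow>
          (divides R C {..<length bs} {\<phi>} (nth bs) \<longleftrightarrow>
             (\<exists>i. \<exists>b\<in>set bs. has_conjunct_eq \<phi> bs i b) \<or>
             (\<phi> \<in> LR k (length bs) C \<and> Kn_phi R n k \<phi> bs C))) \<and>
     (\<forall>A B C.
        small \<kappa> A \<and> small \<kappa> B \<and> small \<kappa> C \<longrightarrow>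
          (indep_d R A C B \<longleftrightarrow>
             A \<inter> B \<subseteq> C \<and>
             (\<forall>bs. set bs \<subseteq> B - C \<and> Kn R n (set bs) (A \<union> C) \<longrightarrow> Kn R n (set bs) C)))"
proof -
  interpret henson_model n \<kappa> R by (rule henson_monster_model) (use assms in auto)
  show ?thesis
    by (intro conjI allI impI; elim conjE) (rule formula_divides_iff indep_d_iff; assumption)+
qed

end
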